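(* Let $(M,g)$ be a Riemannian manifold. The function $(f,a)\mapsto\chi(M^a_f)$ is locally constant on $\mathrm{Reg}^3_{\mathrm{pb}}(M,\mathbb R)_U$, and the function $f\mapsto\chi(M^0_f)$ is locally constant on $\mathcal C^3_{0-\mathrm{reg},c}(M,\mathbb R)_S$, where $\chi$ denotes the Euler–Poincaré characteristic.
   Context: $M$ is without boundary and not necessarily compact. $M^a_f=f^{-1}(]-\infty,a])$. A real number $a$ is a regular value of $f$ if $f(x)=a$ implies $df(x)\neq0$. $\mathrm{Reg}^p_{\mathrm{pb}}(M,\mathbb R)$ is the set of pairs $(f,a)$ with $f\in\mathcal C^p(M,\mathbb R)$ proper and bounded below, and $a\in\mathbb R$ a regular value of $f$. $\mathcal C^p_{0-\mathrm{reg},c}(M,\mathbb R)$ is the set of $f\in\mathcal C^p(M,\mathbb R)$ such that $0$ is a regular value of $f$ and $M^0_f$ is compact. Topologies ($p\in\mathbb N$). With $\nabla^if$ the $i$-th iterated Levi-Civita covariant derivative of $f$, $\|\nabla^if(x)\|$ its norm induced by $g_x$ and $\|\nabla^if\|_\infty$ the supremum over $x\in M$: the uniform $\mathcal C^p$-topology (subscript $U$) on $\mathcal C^p(M,\mathbb R)$ is the translation-invariant topology with neighborhood basis of $0$ the sets $\{f\mid\sum_{i=0}^p\|\nabla^if\|_\infty<\epsilon\}$, $\epsilon>0$; the strong (Whitney) $\mathcal C^p$-topology (subscript $S$) is the one with neighborhood basis of $0$ the sets $\{f\mid\forall x\in M,\ \sum_{i=0}^p\|\nabla^if(x)\|<\epsilon(x)\}$,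 $\epsilon\in\mathcal C^0(M,\mathbb R_{>0})$. $\mathcal C^p(M,\mathbb R)\times\mathbb R$ has the product topology and subsets the subspace topology. *)

theory Defs
  imports "HOL-Analysis.Analysis" "HOL-Homology.Homology"
begin

section \<open>Euler--Poincare characteristic\<close>

text \<open>The largest number of \<open>\<int>\<close>-linearly independent elements. As \<open>Sup\<close> of an unbounded set of
  naturals is unspecified, this is meaningful for groups of finite rank only.\<close>

definition int_independent :: "('b, 'm) monoid_scheme \<Rightarrow> 'b set \<Rightarrow> bool" where
  "int_independent G S \<longleftrightarrow> finite S \<and> S \<subseteq> carrier G \<and>
     (\<forall>k :: 'b \<Rightarrow> int. finprod G (\<lambda>s. s [^]\<^bsub>G\<^esub> k s) S = \<one>\<^bsub>G\<^esub> \<longrightarrow> (\<forall>s\<in>S. k s = 0))"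

definition group_rank :: "('b, 'm) monoid_scheme \<Rightarrow> nat" where
  "group_rank G = Sup {card S | S. int_independent G S}"

definition betti :: "nat \<Rightarrow> 'a topology \<Rightarrow> nat" where
  "betti i X = group_rank (homology_group (int i) X)"

text \<open>Meaningful when all Betti numbers are finite and almost all of them vanish, as for
  the compact manifolds with boundary to which it is applied.\<close>

definition euler_char :: "'a topology \<Rightarrow> int" where
  "euler_char X = (\<Sum>i \<in> {i. betti i X \<noteq> 0}. (- 1) ^ i * int (betti i X))"


section \<open>Differentiability in coordinates\<close>

text \<open>The model space \<open>\<real>\<^sup>n\<close> is \<open>span B\<close> for a set \<open>B\<close> of \<open>n\<close> vectors of \<open>Basis\<close>, which is also used as the
  set of coordinate indices. Taking \<open>B = Basis\<close> alone would exclude \<open>n = 0\<close>, since every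
  Euclidean space type has positive dimension.\<close>

definition pderiv_at :: "'e::euclidean_space \<Rightarrow> ('e \<Rightarrow> real) \<Rightarrow> 'e \<Rightarrow> real" where
  "pderiv_at b F y = deriv (\<lambda>t. F (y + t *\<^sub>R b)) 0"

primrec Ck_on :: "'e::euclidean_space set \<Rightarrow> nat \<Rightarrow> 'e set \<Rightarrow> ('e \<Rightarrow> real) \<Rightarrow> bool" where
  "Ck_on B 0 V F \<longleftrightarrow> continuous_on V F"
| "Ck_on B (Suc k) V F \<longleftrightarrow> continuous_on V F \<and>
     (\<forall>b\<in>B. (\<forall>y\<in>V. (\<lambda>t. F (y + t *\<^sub>R b)) field_differentiable (at 0)) \<and> Ck_on B k V (pderiv_at b F))"

definition smooth_on :: "'e::euclidean_space set \<Rightarrow> 'e set \<Rightarrow> ('e \<Rightarrow> real) \<Rightarrow> bool" where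
  "smooth_on B V F \<longleftrightarrow> (\<forall>k. Ck_on B k V F)"

type_synonym ('a, 'e) chart = "'a set \<times> ('a \<Rightarrow> 'e)"

abbreviation cdom :: "('a, 'e) chart \<Rightarrow> 'a set" where "cdom \<equiv> fst"
abbreviation cmap :: "('a, 'e) chart \<Rightarrow> 'a \<Rightarrow> 'e" where "cmap \<equiv> snd"

definition cinv :: "('a, 'e) chart \<Rightarrow> 'e \<Rightarrow> 'a" where
  "cinv c = inv_into (cdom c) (cmap c)"

definition chart_pderiv ::
    "('a, 'e::euclidean_space) chart \<Rightarrow> 'e \<Rightarrow> ('a \<Rightarrow> real) \<Rightarrow> 'a \<Rightarrow> real" where
  "chart_pderiv c b f x = pderiv_at b (f \<circ> cinv c) (cmap c x)"


section \<open>Riemannian manifolds\<close>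

locale smooth_manifold =
  fixes M :: "'a topology"
    and B :: "'e::euclidean_space set"
    and A :: "('a, 'e) chart set"
  assumes coords: "B \<subseteq> Basis"
    and Hausdorff: "Hausdorff_space M"
    and second_countable: "second_countable M"
    and chart_domain: "\<And>c. c \<in> A \<Longrightarrow> openin M (cdom c)"
    and chart_range: "\<And>c. c \<in> A \<Longrightarrow> openin (top_of_set (span B)) (cmap c ` cdom c)"
    and chart_homeo: "\<And>c. c \<in> A \<Longrightarrow>
      homeomorphic_map (subtopology M (cdom c)) (top_of_set (cmap c ` cdom c)) (cmap c)"
    and chart_cover: "(\<Union>c\<in>A. cdom c) = topspace M"
    and chart_transition: "\<And>c d b. c \<in> A \<Longrightarrow> d \<in> A \<Longrightarrow> b \<in> B \<Longrightarrow>
      smooth_on B (cmap c ` (cdom c \<inter> cdom d)) (\<lambda>y. cmap d (cinv c y) \<bullet> b)"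

text \<open>The metric tensor is given by its components \<open>g\<^sub>i\<^sub>j\<close> on each chart domain, subject to the
  transformation law of a tensor of type \<open>(0,2)\<close>.\<close>

locale riemannian_manifold = smooth_manifold M B A
  for M :: "'a topology" and B :: "'e::euclidean_space set" and A :: "('a, 'e) chart set" +
  fixes g :: "('a, 'e) chart \<Rightarrow> 'e \<Rightarrow> 'e \<Rightarrow> 'a \<Rightarrow> real"
  assumes metric_smooth: "\<And>c i j. c \<in> A \<Longrightarrow> i \<in> B \<Longrightarrow> j \<in> B \<Longrightarrow>
      smooth_on B (cmap c ` cdom c) (g c i j \<circ> cinv c)"
    and metric_sym: "\<And>c i j x. c \<in> A \<Longrightarrow> i \<in> B \<Longrightarrow> j \<in> B \<Longrightarrow> x \<in> cdom c \<Longrightarrow> g c i j x = g c j i x"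
    and metric_pos: "\<And>c x v. c \<in> A \<Longrightarrow> x \<in> cdom c \<Longrightarrow> \<exists>i\<in>B. v i \<noteq> 0 \<Longrightarrow>
      (\<Sum>i\<in>B. \<Sum>j\<in>B. g c i j x * v i * v j) > 0"
    and metric_transform: "\<And>c d i j x. c \<in> A \<Longrightarrow> d \<in> A \<Longrightarrow> x \<in> cdom c \<inter> cdom d \<Longrightarrow> i \<in> B \<Longrightarrow> j \<in> B \<Longrightarrow>
      g c i j x = (\<Sum>k\<in>B. \<Sum>l\<in>B. g d k l x * chart_pderiv c i (\<lambda>z. cmap d z \<bullet> k) x
                                        * chart_pderiv c j (\<lambda>z. cmap d z \<bullet> l) x)"


section \<open>Functions of class \<open>C\<^sup>p\<close>, regular values, sublevel sets\<close>

context smooth_manifold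
begin

definition Cp :: "nat \<Rightarrow> ('a \<Rightarrow> real) set" where
  "Cp p = {f \<in> extensional (topspace M). \<forall>c\<in>A. Ck_on B p (cmap c ` cdom c) (f \<circ> cinv c)}"

definition differential_nonzero :: "('a \<Rightarrow> real) \<Rightarrow> 'a \<Rightarrow> bool" where
  "differential_nonzero f x \<longleftrightarrow> (\<exists>c\<in>A. x \<in> cdom c \<and> (\<exists>b\<in>B. chart_pderiv c b f x \<noteq> 0))"

definition regular_value :: "('a \<Rightarrow> real) \<Rightarrow> real \<Rightarrow> bool" where
  "regular_value f a \<longleftrightarrow> (\<forall>x\<in>topspace M. f x = a \<longrightarrow> differential_nonzero f x)"

definition sublevel :: "('a \<Rightarrow> real) \<Rightarrow> real \<Rightarrow> 'a set" where
  "sublevel f a = {x \<in> topspace M. f x \<le> a}"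

definition Reg_pb :: "nat \<Rightarrow> (('a \<Rightarrow> real) \<times> real) set" where
  "Reg_pb p = {(f, a). f \<in> Cp p \<and> proper_map M euclideanreal f \<and> bdd_below (f ` topspace M) \<and>
                       regular_value f a}"

definition C_0reg_c :: "nat \<Rightarrow> ('a \<Rightarrow> real) set" where
  "C_0reg_c p = {f \<in> Cp p. regular_value f 0 \<and> compactin M (sublevel f 0)}"

end


section \<open>Iterated Levi-Civita derivatives and the function space topologies\<close>

definition translation_topology ::
    "'f set \<Rightarrow> ('f \<Rightarrow> 'f \<Rightarrow> 'f) \<Rightarrow> 'f set set \<Rightarrow> 'f topology" where
  "translation_topology C diff \<N> =
     topology (\<lambda>W. W \<subseteq> C \<and> (\<forall>f\<in>W. \<exists>N\<in>\<N>. {h \<in> C. diff h f \<in> N} \<subseteq> W))"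

lemma openin_translation_topology:
  assumes "\<And>N N'. N \<in> \<N> \<Longrightarrow> N' \<in> \<N> \<Longrightarrow> \<exists>N''\<in>\<N>. N'' \<subseteq> N \<inter> N'"
  shows "openin (translation_topology C diff \<N>) W \<longleftrightarrow>
    W \<subseteq> C \<and> (\<forall>f\<in>W. \<exists>N\<in>\<N>. {h \<in> C. diff h f \<in> N} \<subseteq> W)"
proof -
  define P where "P W \<longleftrightarrow> W \<subseteq> C \<and> (\<forall>f\<in>W. \<exists>N\<in>\<N>. {h \<in> C. diff h f \<in> N} \<subseteq> W)" for W
  have int: "P (S \<inter> T)" if S: "P S" and T: "P T" for S T
    unfolding P_def
  proof (intro conjI ballI)
    show "S \<inter> T \<subseteq> C" using S unfolding P_def by auto
    fix f assume f: "f \<in> S \<inter> T"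
    obtain N where N: "N \<in> \<N>" "{h \<in> C. diff h f \<in> N} \<subseteq> S" using f S unfolding P_def by auto
    obtain N' where N': "N' \<in> \<N>" "{h \<in> C. diff h f \<in> N'} \<subseteq> T" using f T unfolding P_def by auto
    obtain N'' where "N'' \<in> \<N>" "N'' \<subseteq> N \<inter> N'" using assms[OF N(1) N'(1)] by auto
    then show "\<exists>N\<in>\<N>. {h \<in> C. diff h f \<in> N} \<subseteq> S \<inter> T" using N(2) N'(2) by (intro bexI[of _ N'']) auto
  qed
  have un: "P (\<Union>\<K>)" if K: "\<forall>S\<in>\<K>. P S" for \<K>
    unfolding P_def
  proof (intro conjI ballI)
    show "\<Union>\<K> \<subseteq> C" using K unfolding P_def by auto
    fix f assume "f \<in> \<Union>\<K>"
    then obtain S where S: "S \<in> \<K>" "f \<in> S" by auto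
    then obtain N where "N \<in> \<N>" "{h \<in> C. diff h f \<in> N} \<subseteq> S"
      using bspec[OF K S(1)] S(2) unfolding P_def by auto
    then show "\<exists>N\<in>\<N>. {h \<in> C. diff h f \<in> N} \<subseteq> \<Union>\<K>" using S by (intro bexI[of _ N]) auto
  qed
  have "istopology P" unfolding istopology_def using int un by simp
  then have "openin (topology P) W \<longleftrightarrow> P W" by (simp add: topology_inverse')
  moreover have "translation_topology C diff \<N> = topology P"
    unfolding translation_topology_def P_def ..
  ultimately show ?thesis by (simp add: P_def)
qed

context riemannian_manifold
begin

definition ginv :: "('a, 'e) chart \<Rightarrow> 'e \<Rightarrow> 'e \<Rightarrow> 'a \<Rightarrow> real" where
  "ginv c i j x = (THE h. (\<forall>i j. i \<notin> B \<or> j \<notin> B \<longrightarrow> h i j = 0) \<and>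
     (\<forall>i\<in>B. \<forall>j\<in>B. (\<Sum>k\<in>B. h i k * g c k j x) = (if i = j then 1 else 0))) i j"

text \<open>\<open>christoffel c k i j\<close> is \<open>\<Gamma>\<^sup>k\<^sub>i\<^sub>j\<close>.\<close>

definition christoffel :: "('a, 'e) chart \<Rightarrow> 'e \<Rightarrow> 'e \<Rightarrow> 'e \<Rightarrow> 'a \<Rightarrow> real" where
  "christoffel c k i j x = (1 / 2) * (\<Sum>l\<in>B. ginv c k l x *
     (chart_pderiv c i (g c j l) x + chart_pderiv c j (g c i l) x - chart_pderiv c l (g c i j) x))"

text \<open>\<open>nabla c f [j\<^sub>1, \<dots>, j\<^sub>i]\<close> is the component of \<open>\<nabla>\<^sup>if\<close> with these indices in the chart \<open>c\<close>;
  the outermost derivative is in direction \<open>j\<^sub>1\<close>.\<close>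

fun nabla :: "('a, 'e) chart \<Rightarrow> ('a \<Rightarrow> real) \<Rightarrow> 'e list \<Rightarrow> 'a \<Rightarrow> real" where
  "nabla c f [] = f"
| "nabla c f (j # J) = (\<lambda>x. chart_pderiv c j (nabla c f J) x
     - (\<Sum>l<length J. \<Sum>k\<in>B. christoffel c k j (J ! l) x * nabla c f (J[l := k]) x))"

definition multi_indices :: "nat \<Rightarrow> 'e list set" where
  "multi_indices i = {J. set J \<subseteq> B \<and> length J = i}"

definition nabla_norm_in :: "('a, 'e) chart \<Rightarrow> nat \<Rightarrow> ('a \<Rightarrow> real) \<Rightarrow> 'a \<Rightarrow> real" where
  "nabla_norm_in c i f x = sqrt (\<Sum>I\<in>multi_indices i. \<Sum>J\<in>multi_indices i.
     (\<Prod>l<i. ginv c (I ! l) (J ! l) x) * nabla c f I x * nabla c f J x)"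

text \<open>For \<open>f\<close> of class \<open>C\<^sup>i\<close>, the value does not depend on the choice of the chart around \<open>x\<close>.\<close>

definition nabla_norm :: "nat \<Rightarrow> ('a \<Rightarrow> real) \<Rightarrow> 'a \<Rightarrow> real" where
  "nabla_norm i f x = nabla_norm_in (SOME c. c \<in> A \<and> x \<in> cdom c) i f x"

definition nabla_supnorm :: "nat \<Rightarrow> ('a \<Rightarrow> real) \<Rightarrow> ennreal" where
  "nabla_supnorm i f = (SUP x\<in>topspace M. ennreal (nabla_norm i f x))"

definition fun_diff :: "('a \<Rightarrow> real) \<Rightarrow> ('a \<Rightarrow> real) \<Rightarrow> 'a \<Rightarrow> real" where
  "fun_diff h f = (\<lambda>x\<in>topspace M. h x - f x)"

definition uniform_nhds :: "nat \<Rightarrow> ('a \<Rightarrow> real) set set" where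
  "uniform_nhds p = {{f \<in> Cp p. (\<Sum>i\<le>p. nabla_supnorm i f) < ennreal \<epsilon>} | \<epsilon>. \<epsilon> > 0}"

definition strong_nhds :: "nat \<Rightarrow> ('a \<Rightarrow> real) set set" where
  "strong_nhds p = {{f \<in> Cp p. \<forall>x\<in>topspace M. (\<Sum>i\<le>p. nabla_norm i f x) < \<epsilon> x} | \<epsilon>.
     continuous_map M euclideanreal \<epsilon> \<and> (\<forall>x\<in>topspace M. \<epsilon> x > 0)}"

definition uniform_Cp_topology :: "nat \<Rightarrow> ('a \<Rightarrow> real) topology" where
  "uniform_Cp_topology p = translation_topology (Cp p) fun_diff (uniform_nhds p)"

definition strong_Cp_topology :: "nat \<Rightarrow> ('a \<Rightarrow> real) topology" where
  "strong_Cp_topology p = translation_topology (Cp p) fun_diff (strong_nhds p)"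

lemma openin_uniform_Cp_topology:
  "openin (uniform_Cp_topology p) W \<longleftrightarrow>
    W \<subseteq> Cp p \<and> (\<forall>f\<in>W. \<exists>N\<in>uniform_nhds p. {h \<in> Cp p. fun_diff h f \<in> N} \<subseteq> W)"
  unfolding uniform_Cp_topology_def
proof (rule openin_translation_topology)
  fix N N' assume "N \<in> uniform_nhds p" "N' \<in> uniform_nhds p"
  then obtain \<epsilon> \<epsilon>' where \<epsilon>: "\<epsilon> > 0" "N = {f \<in> Cp p. (\<Sum>i\<le>p. nabla_supnorm i f) < ennreal \<epsilon>}"
    and \<epsilon>': "\<epsilon>' > 0" "N' = {f \<in> Cp p. (\<Sum>i\<le>p. nabla_supnorm i f) < ennreal \<epsilon>'}"
    unfolding uniform_nhds_def by auto
  let ?N = "{f \<in> Cp p. (\<Sum>i\<le>p. nabla_supnorm i f) < ennreal (min \<epsilon> \<epsilon>')}"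
  have "ennreal (min \<epsilon> \<epsilon>') \<le> ennreal \<epsilon>" "ennreal (min \<epsilon> \<epsilon>') \<le> ennreal \<epsilon>'"
    by (simp_all add: ennreal_leI)
  then have "?N \<subseteq> N \<inter> N'"
    unfolding \<epsilon>(2) \<epsilon>'(2) by (auto elim: order_less_le_trans)
  moreover have "?N \<in> uniform_nhds p"
    unfolding uniform_nhds_def using \<epsilon>(1) \<epsilon>'(1)
    by (intro CollectI exI[of _ "min \<epsilon> \<epsilon>'"] conjI refl) simp
  ultimately show "\<exists>N''\<in>uniform_nhds p. N'' \<subseteq> N \<inter> N'" by (rule bexI)
qed

lemma openin_strong_Cp_topology:
  "openin (strong_Cp_topology p) W \<longleftrightarrow>
    W \<subseteq> Cp p \<and> (\<forall>f\<in>W. \<exists>N\<in>strong_nhds p. {h \<in> Cp p. fun_diff h f \<in> N} \<subseteq> W)"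
  unfolding strong_Cp_topology_def
proof (rule openin_translation_topology)
  fix N N' assume "N \<in> strong_nhds p" "N' \<in> strong_nhds p"
  then obtain \<epsilon> \<epsilon>' where
    \<epsilon>: "continuous_map M euclideanreal \<epsilon>" "\<forall>x\<in>topspace M. \<epsilon> x > 0"
      "N = {f \<in> Cp p. \<forall>x\<in>topspace M. (\<Sum>i\<le>p. nabla_norm i f x) < \<epsilon> x}"
    and \<epsilon>': "continuous_map M euclideanreal \<epsilon>'" "\<forall>x\<in>topspace M. \<epsilon>' x > 0"
      "N' = {f \<in> Cp p. \<forall>x\<in>topspace M. (\<Sum>i\<le>p. nabla_norm i f x) < \<epsilon>' x}"
    unfolding strong_nhds_def by auto
  let ?m = "\<lambda>x. min (\<epsilon> x) (\<epsilon>' x)"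
  let ?N = "{f \<in> Cp p. \<forall>x\<in>topspace M. (\<Sum>i\<le>p. nabla_norm i f x) < ?m x}"
  have "?N \<subseteq> N \<inter> N'"
    unfolding \<epsilon>(3) \<epsilon>'(3) by auto
  moreover have "?N \<in> strong_nhds p"
    unfolding strong_nhds_def using \<epsilon>(1,2) \<epsilon>'(1,2)
    by (intro CollectI exI[of _ ?m] conjI refl) (simp_all add: continuous_map_real_min)
  ultimately show "\<exists>N''\<in>strong_nhds p. N'' \<subseteq> N \<inter> N'" by (rule bexI)
qed

end


definition locally_constant :: "'b topology \<Rightarrow> ('b \<Rightarrow> 'c) \<Rightarrow> bool" where
  "locally_constant X F \<longleftrightarrow>
     (\<forall>z\<in>topspace X. \<exists>W. openin X W \<and> z \<in> W \<and> (\<forall>w\<in>W. F w = F z))"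

end

theory Submission
  imports Defs
begin

text \<open>
  No flow is needed. Around a point where \<open>df \<noteq> 0\<close>, translate in a chart along a coordinate direction
  in which \<open>f\<close> decreases, by a distance \<open>t \<phi>(x)\<close> with a bump function \<open>\<phi>\<close>. Composing finitely many of these
  pushes gives a homotopy \<open>T\<^sub>t\<close> of \<open>M\<close> starting at the identity such that \<open>h \<circ> T\<^sub>t \<le> h\<close> for every \<open>h\<close> that
  is \<open>C\<^sup>1\<close>-near \<open>f\<close>, and \<open>f \<circ> T\<^sub>1 < f\<close> on the compact level set \<open>f = a\<close>. If in addition \<open>h - b\<close> is close
  enough to \<open>f - a\<close>, then \<open>T\<^sub>1\<close> maps \<open>{f \<le> a}\<close> into \<open>{h \<le> b}\<close> and vice versa. These two maps are mutually
  inverse up to the homotopy \<open>T\<^sub>t \<circ> T\<^sub>t\<close>, which preserves both sublevel sets, so the sublevel sets have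
  the same homology.
\<close>

section \<open>Homotopy invariance of the Euler characteristic\<close>

text \<open>A single homotopy, built from \<open>f\<close> alone, has to serve all perturbations
  \<open>h\<close> simultaneously; this is why \<open>descent\<close> carries a radius
  \<open>\<delta>\<close> within which \<open>h\<close> may vary. A push needs a bound on the
  partial derivatives of \<open>h - f\<close> in its own chart, whereas the neighbourhoods are given
  by norms evaluated in an arbitrarily selected chart around each point. \<open>C1_near\<close>
  mediates: it speaks of all charts, and the Cauchy-Schwarz inequality for the metric and its
  inverse derives it from the first covariant derivative. A homotopy equivalence asks only for
  continuity, so a tent function serves as bump, and monotonicity of \<open>h\<close> is
  one-variable calculus on segments. The manifold may be noncompact, so a lower bound for the drop
  \<open>max (f x - a) (a - f (T (1, x)))\<close> has to be secured. For proper functions bounded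
  below, the drop has a positive minimum on the compact set \<open>f \<le> a + 1\<close>, and a
  constant suits the uniform topology. If only \<open>f \<le> 0\<close> is known to be compact, the
  drop itself, a positive continuous function, enters the weight that the strong topology
  allows.\<close>

lemma hom_finprod_comm_group:
  assumes "comm_group G" "comm_group H" "h \<in> hom G H" "finite S" "f \<in> S \<rightarrow> carrier G"
  shows "h (finprod G f S) = finprod H (\<lambda>s. h (f s)) S"
proof -
  interpret G: comm_group G by fact
  interpret H: comm_group H by fact
  interpret h: group_hom G H h
    using assms(3) by (simp add: group_hom.intro group_hom_axioms.intro G.is_group H.is_group)
  show ?thesis
    using assms(4,5)
  proof (induction S rule: finite_induct)
    case (insert x F)
    then have f: "f \<in> F \<rightarrow> carrier G" "f x \<in> carrier G" by auto
    moreover have "(\<lambda>s. h (f s)) \<in> F \<rightarrow> carrier H" "h (f x) \<in> carrier H"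
      using f h.hom_closed by (auto simp: Pi_iff)
    ultimately show ?case using insert by simp
  qed simp
qed

text \<open>A relation among the images with coefficients \<open>k\<close> pulls back, by
  injectivity, to the relation among the originals with coefficients \<open>k (h s)\<close>.\<close>

lemma int_independent_iso_image:
  assumes "comm_group G" "comm_group H" "h \<in> iso G H" "int_independent G S"
  shows "int_independent H (h ` S)" "card (h ` S) = card S"
proof -
  interpret G: comm_group G by fact
  interpret H: comm_group H by fact
  have hom: "h \<in> hom G H" and bij: "bij_betw h (carrier G) (carrier H)"
    using assms(3) by (auto simp: iso_def)
  interpret h: group_hom G H h
    using hom by (simp add: group_hom.intro group_hom_axioms.intro G.is_group H.is_group)
  have S: "finite S" "S \<subseteq> carrier G" using assms(4) by (auto simp: int_independent_def)
  have inj: "inj_on h S" using bij S by (auto simp: bij_betw_def intro: inj_on_subset)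
  show "card (h ` S) = card S" by (rule card_image[OF inj])
  show "int_independent H (h ` S)"
    unfolding int_independent_def
  proof (intro conjI allI impI ballI)
    show "finite (h ` S)" using S by simp
    show "h ` S \<subseteq> carrier H" using S by auto
    fix k :: "'c \<Rightarrow> int" and t
    assume k: "finprod H (\<lambda>s. s [^]\<^bsub>H\<^esub> k s) (h ` S) = \<one>\<^bsub>H\<^esub>" and t: "t \<in> h ` S"
    let ?f = "\<lambda>s. s [^]\<^bsub>G\<^esub> k (h s)"
    have f: "?f \<in> S \<rightarrow> carrier G" using S by auto
    have "h (finprod G ?f S) = finprod H (\<lambda>s. h (?f s)) S"
      by (rule hom_finprod_comm_group[OF assms(1,2) hom S(1) f])
    also have "\<dots> = finprod H (\<lambda>s. h s [^]\<^bsub>H\<^esub> k (h s)) S"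
      using S by (intro H.finprod_cong) (auto simp: h.hom_int_pow simp_implies_def)
    also have "\<dots> = finprod H (\<lambda>s. s [^]\<^bsub>H\<^esub> k s) (h ` S)"
      using S inj by (subst H.finprod_reindex) auto
    also have "\<dots> = h \<one>\<^bsub>G\<^esub>" using k by simp
    finally have "finprod G ?f S = \<one>\<^bsub>G\<^esub>"
      using bij f by (auto simp: bij_betw_def inj_on_def G.finprod_closed)
    then have "\<forall>s\<in>S. k (h s) = 0"
      using assms(4) unfolding int_independent_def by (elim conjE allE[of _ "\<lambda>s. k (h s)"]) simp
    then show "k t = 0" using t by auto
  qed
qed

text \<open>The sets of attained cardinalities are equal as sets, so the ranks agree even where
  these sets are unbounded and \<open>Sup\<close> is an unspecified number.\<close>

lemma group_rank_iso:
  assumes "comm_group G" "comm_group H" "G \<cong> H"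
  shows "group_rank G = group_rank H"
proof -
  obtain h where h: "h \<in> iso G H" using assms(3) by (auto simp: is_iso_def)
  then have h': "inv_into (carrier G) h \<in> iso H G"
    using assms(1) by (simp add: comm_group.axioms(2) group.iso_set_sym)
  have "{card S | S. int_independent G S} = {card S | S. int_independent H S}"
    using int_independent_iso_image[OF assms(1,2) h] int_independent_iso_image[OF assms(2,1) h']
    by (metis (no_types, lifting))
  then show ?thesis by (simp add: group_rank_def)
qed

lemma homotopy_equivalent_space_imp_euler_char_eq:
  assumes "X homotopy_equivalent_space Y"
  shows "euler_char X = euler_char Y"
proof -
  have "betti i X = betti i Y" for i
    unfolding betti_def
    using homotopy_equivalent_space_imp_isomorphic_homology_groups[OF assms]
    by (intro group_rank_iso abelian_homology_group)
  then show ?thesis by (simp add: euler_char_def)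
qed


section \<open>Positive definite forms and their tensor powers\<close>

text \<open>Gram-Schmidt: the vectors \<open>E a\<close> form an orthonormal basis for
  \<open>G\<close>. The conclusion is the expansion of a coordinate vector in this basis; in matrix
  terms it says that the transpose of \<open>E\<close> times \<open>E\<close> is a right inverse of
  \<open>G\<close>.\<close>

lemma pos_def_frame_exists:
  fixes G :: "'i \<Rightarrow> 'i \<Rightarrow> real"
  assumes B: "finite B"
    and sym: "\<And>i j. i \<in> B \<Longrightarrow> j \<in> B \<Longrightarrow> G i j = G j i"
    and pos: "\<And>v. \<exists>i\<in>B. v i \<noteq> 0 \<Longrightarrow> (\<Sum>i\<in>B. \<Sum>j\<in>B. G i j * v i * v j) > 0"
  shows "\<exists>E. \<forall>k\<in>B. \<forall>i\<in>B.
    (\<Sum>a\<in>B. (\<Sum>j\<in>B. G k j * E a j) * E a i) = (if k = i then 1 else 0)"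
proof -
  define ip where "ip v w = (\<Sum>i\<in>B. \<Sum>j\<in>B. G i j * v i * w j)" for v w
  define un where "un k = (\<lambda>i. if i = k then 1 else 0::real)" for k :: 'i
  have ip_sym: "ip v w = ip w v" for v w
    unfolding ip_def by (subst sum.swap) (auto intro!: sum.cong simp: sym)
  have ip_diff: "ip (\<lambda>i. v i - w i) u = ip v u - ip w u" for v w u
    by (simp add: ip_def algebra_simps sum_subtractf)
  have ip_div: "ip (\<lambda>i. v i / c) u = ip v u / c" for v c u
    by (simp add: ip_def sum_divide_distrib)
  have ip_scale: "ip (\<lambda>i. c * v i) u = c * ip v u" for v c u
    by (simp add: ip_def sum_distrib_left algebra_simps)
  have ip_add: "ip (\<lambda>i. v i + w i) u = ip v u + ip w u" for v w u
    by (simp add: ip_def algebra_simps sum.distrib)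
  have ip_zero: "ip (\<lambda>i. 0) u = 0" for u by (simp add: ip_def)
  have ip_sum: "ip (\<lambda>i. \<Sum>a\<in>T. c a * V a i) u = (\<Sum>a\<in>T. c a * ip (V a) u)"
    if "finite T" for T :: "'i set" and c V u
    using that by (induction T rule: finite_induct) (simp_all add: ip_add ip_scale ip_zero)
  \<comment> \<open>The invariant of the induction. Orthonormality and expansion are the goal; the
    support condition guarantees that the next coordinate vector is not in the span of the vectors
    already built.\<close>
  define frame where "frame T E \<longleftrightarrow> (\<forall>a\<in>T. \<forall>i. i \<notin> T \<longrightarrow> E a i = 0) \<and>
      (\<forall>a\<in>T. \<forall>b\<in>T. ip (E a) (E b) = (if a = b then 1 else 0)) \<and>
      (\<forall>k\<in>T. \<forall>i. un k i = (\<Sum>a\<in>T. ip (un k) (E a) * E a i))" for T E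
  have "\<exists>E. frame T E" if "finite T" "T \<subseteq> B" for T
    using that
  proof (induction T rule: finite_induct)
    case (insert k T)
    then obtain E where "frame T E" by auto
    then have supp: "\<And>a i. a \<in> T \<Longrightarrow> i \<notin> T \<Longrightarrow> E a i = 0"
      and on: "\<And>a b. a \<in> T \<Longrightarrow> b \<in> T \<Longrightarrow> ip (E a) (E b) = (if a = b then 1 else 0)"
      and full: "\<And>k i. k \<in> T \<Longrightarrow> un k i = (\<Sum>a\<in>T. ip (un k) (E a) * E a i)"
      unfolding frame_def by blast+
    define w where "w i = un k i - (\<Sum>a\<in>T. ip (un k) (E a) * E a i)" for i
    have wE: "ip w (E b) = 0" if "b \<in> T" for b
    proof -
      have "(\<Sum>a\<in>T. ip (un k) (E a) * ip (E a) (E b)) = (\<Sum>a\<in>T. if a = b then ip (un k) (E a) else 0)"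
        using that by (intro sum.cong) (auto simp: on)
      also have "\<dots> = ip (un k) (E b)" using insert.hyps that by simp
      finally show ?thesis
        unfolding w_def ip_diff using insert.hyps by (subst ip_sum) auto
    qed
    \<comment> \<open>All earlier \<open>E a\<close> vanish at the new index \<open>k\<close>, so
      \<open>w\<close> is nonzero and can be normalised.\<close>
    have "w k = 1" using insert.hyps supp by (simp add: w_def un_def)
    then have ww: "ip w w > 0"
      unfolding ip_def using insert.prems by (intro pos bexI[of _ k]) auto
    define n where "n = sqrt (ip w w)"
    have n: "n > 0" "n * n = ip w w" using ww by (auto simp: n_def)
    define e where "e i = w i / n" for i
    have ew: "ip v e = ip v w / n" for v
      using ip_sym[of v e] ip_sym[of v w] ip_div[of w n v] by (simp add: e_def[abs_def])
    have ee: "ip e e = 1" using ip_sym[of e w] n ww by (simp add: ew)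
    have Ee: "ip (E b) e = 0" "ip e (E b) = 0" if "b \<in> T" for b
      using wE[OF that] ip_sym[of "E b" w] ip_sym[of e "E b"] by (simp_all add: ew)
    have ue: "ip (un m) e = 0" if "m \<in> T" for m
    proof -
      have "ip (un m) e = ip (\<lambda>i. \<Sum>a\<in>T. ip (un m) (E a) * E a i) e"
        using full[OF that] by (metis (no_types, lifting) ext)
      also have "\<dots> = (\<Sum>a\<in>T. ip (un m) (E a) * ip (E a) e)" by (rule ip_sum) fact
      also have "\<dots> = 0" by (simp add: Ee)
      finally show ?thesis .
    qed
    \<comment> \<open>\<open>un k\<close> differs from \<open>w\<close> only by vectors orthogonal
      to \<open>w\<close>. This lets the expansion of \<open>un k\<close> close with the single new
      term along \<open>e\<close>.\<close>
    have uw: "ip (un k) w = ip w w"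
    proof -
      have "ip w w = ip (un k) w - ip (\<lambda>i. \<Sum>a\<in>T. ip (un k) (E a) * E a i) w"
        by (subst (1) w_def[abs_def]) (rule ip_diff)
      also have "ip (\<lambda>i. \<Sum>a\<in>T. ip (un k) (E a) * E a i) w = 0"
        using insert.hyps wE by (subst ip_sum) (auto simp: ip_sym[of _ w])
      finally show ?thesis by simp
    qed
    define E' where "E' = E(k := e)"
    have E'T: "E' a = E a" if "a \<in> T" for a using that insert.hyps by (auto simp: E'_def)
    have E'k: "E' k = e" by (simp add: E'_def)
    show ?case
      unfolding frame_def
    proof (intro exI[of _ E'] conjI ballI allI impI)
      fix a i assume "a \<in> insert k T" "i \<notin> insert k T"
      then show "E' a i = 0"
        using supp by (cases "a = k") (auto simp: E'T E'k e_def w_def un_def)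
    next
      fix a b assume "a \<in> insert k T" "b \<in> insert k T"
      then show "ip (E' a) (E' b) = (if a = b then 1 else 0)"
        using insert.hyps by (cases "a = k"; cases "b = k") (auto simp: E'T E'k ee Ee on)
    next
      fix m i assume m: "m \<in> insert k T"
      have *: "(\<Sum>a\<in>insert k T. ip (un m) (E' a) * E' a i) =
          ip (un m) e * e i + (\<Sum>a\<in>T. ip (un m) (E a) * E a i)"
        using insert.hyps by (simp add: E'T E'k)
      show "un m i = (\<Sum>a\<in>insert k T. ip (un m) (E' a) * E' a i)"
      proof (cases "m = k")
        case True
        have "ip (un k) e * e i = ip w w / (n * n) * w i" by (simp add: ew uw e_def)
        also have "\<dots> = w i" using n ww by simp
        finally show ?thesis using * unfolding True by (simp add: w_def)
      next
        case False
        then show ?thesis unfolding * using m ue full by simp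
      qed
    qed
  qed (simp add: frame_def[abs_def])
  from this[OF B order_refl] obtain E where
    full: "\<And>k i. k \<in> B \<Longrightarrow> un k i = (\<Sum>a\<in>B. ip (un k) (E a) * E a i)"
    unfolding frame_def by blast
  show ?thesis
  proof (intro exI ballI)
    fix k i assume "k \<in> B" "i \<in> B"
    have "ip (un k) v = (\<Sum>j\<in>B. G k j * v j)" for v
    proof -
      have "ip (un k) v = (\<Sum>l\<in>B. if l = k then (\<Sum>j\<in>B. G l j * v j) else 0)"
        unfolding ip_def by (intro sum.cong) (auto simp: un_def)
      then show ?thesis using B \<open>k \<in> B\<close> by simp
    qed
    then show "(\<Sum>a\<in>B. (\<Sum>j\<in>B. G k j * E a j) * E a i) = (if k = i then 1 else 0)"
      using full[OF \<open>k \<in> B\<close>, of i] by (simp add: un_def eq_commute)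
  qed
qed

lemma dual_form_sum_squares:
  fixes E :: "'i \<Rightarrow> 'i \<Rightarrow> real"
  shows "(\<Sum>i\<in>B. \<Sum>j\<in>B. (\<Sum>a\<in>B. E a i * E a j) * p i * p j) = (\<Sum>a\<in>B. (\<Sum>i\<in>B. E a i * p i)\<^sup>2)"
proof -
  have "(\<Sum>a\<in>B. (\<Sum>i\<in>B. E a i * p i)\<^sup>2) = (\<Sum>a\<in>B. \<Sum>i\<in>B. \<Sum>j\<in>B. E a i * E a j * p i * p j)"
    by (simp add: power2_eq_square sum_product algebra_simps)
  also have "\<dots> = (\<Sum>i\<in>B. \<Sum>a\<in>B. \<Sum>j\<in>B. E a i * E a j * p i * p j)" by (rule sum.swap)
  also have "\<dots> = (\<Sum>i\<in>B. \<Sum>j\<in>B. \<Sum>a\<in>B. E a i * E a j * p i * p j)"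
    by (intro sum.cong refl sum.swap)
  finally show ?thesis by (simp add: sum_distrib_right)
qed

text \<open>A vector \<open>w\<close> is paired with a covector \<open>p\<close>. In the frame
  \<open>E\<close> they have the coordinates \<open>W a\<close> and
  \<open>\<Sum>i\<in>B. E a i * p i\<close>; the pairing and both lengths take their standard form
  there, and the ordinary inequality applies.\<close>

lemma dual_form_Cauchy_Schwarz:
  fixes G E :: "'i \<Rightarrow> 'i \<Rightarrow> real"
  assumes B: "finite B"
    and E: "\<And>k i. k \<in> B \<Longrightarrow> i \<in> B \<Longrightarrow>
      (\<Sum>a\<in>B. (\<Sum>j\<in>B. G k j * E a j) * E a i) = (if k = i then 1 else 0)"
  shows "\<bar>\<Sum>i\<in>B. w i * p i\<bar> \<le> sqrt (\<Sum>i\<in>B. \<Sum>j\<in>B. G i j * w i * w j) *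
    sqrt (\<Sum>i\<in>B. \<Sum>j\<in>B. (\<Sum>a\<in>B. E a i * E a j) * p i * p j)"
proof -
  define W where "W a = (\<Sum>k\<in>B. w k * (\<Sum>j\<in>B. G k j * E a j))" for a
  have w: "(\<Sum>a\<in>B. W a * E a i) = w i" if "i \<in> B" for i
  proof -
    have "(\<Sum>a\<in>B. W a * E a i) = (\<Sum>a\<in>B. \<Sum>k\<in>B. w k * ((\<Sum>j\<in>B. G k j * E a j) * E a i))"
      by (simp only: W_def sum_distrib_right mult.assoc)
    also have "\<dots> = (\<Sum>k\<in>B. \<Sum>a\<in>B. w k * ((\<Sum>j\<in>B. G k j * E a j) * E a i))" by (rule sum.swap)
    also have "\<dots> = (\<Sum>k\<in>B. if k = i then w k else 0)"
      using that by (intro sum.cong refl) (simp add: sum_distrib_left[symmetric] E)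
    finally show ?thesis using that B by simp
  qed
  have "(\<Sum>i\<in>B. w i * p i) = (\<Sum>i\<in>B. (\<Sum>a\<in>B. W a * E a i) * p i)"
    using w by (intro sum.cong) auto
  also have "\<dots> = (\<Sum>i\<in>B. \<Sum>a\<in>B. W a * (E a i * p i))"
    by (simp add: sum_distrib_right mult.assoc)
  also have "\<dots> = (\<Sum>a\<in>B. W a * (\<Sum>i\<in>B. E a i * p i))"
    by (subst sum.swap) (simp add: sum_distrib_left)
  finally have wp: "(\<Sum>i\<in>B. w i * p i) = (\<Sum>a\<in>B. W a * (\<Sum>i\<in>B. E a i * p i))" .
  have "(\<Sum>a\<in>B. W a * W a) = (\<Sum>a\<in>B. \<Sum>k\<in>B. W a * (\<Sum>j\<in>B. G k j * E a j) * w k)"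
    by (subst (2) W_def)
      (simp add: sum_distrib_left[where f = "\<lambda>k. w k * _ k"] mult.assoc mult.commute mult.left_commute)
  also have "\<dots> = (\<Sum>k\<in>B. \<Sum>a\<in>B. W a * (\<Sum>j\<in>B. G k j * E a j) * w k)" by (rule sum.swap)
  also have "\<dots> = (\<Sum>k\<in>B. (\<Sum>a\<in>B. \<Sum>j\<in>B. W a * (G k j * E a j)) * w k)"
    by (simp add: sum_distrib_right sum_distrib_left)
  also have "\<dots> = (\<Sum>k\<in>B. (\<Sum>j\<in>B. \<Sum>a\<in>B. G k j * (W a * E a j)) * w k)"
    by (subst (2) sum.swap) (simp add: mult.left_commute)
  also have "\<dots> = (\<Sum>k\<in>B. (\<Sum>j\<in>B. G k j * w j) * w k)"
    by (simp add: sum_distrib_left[symmetric] w)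
  finally have WW: "(\<Sum>a\<in>B. (W a)\<^sup>2) = (\<Sum>i\<in>B. \<Sum>j\<in>B. G i j * w i * w j)"
    by (simp add: sum_distrib_left power2_eq_square mult.assoc mult.commute mult.left_commute)
  have "\<bar>\<Sum>i\<in>B. w i * p i\<bar> \<le> sqrt ((\<Sum>a\<in>B. (W a)\<^sup>2) * (\<Sum>a\<in>B. (\<Sum>i\<in>B. E a i * p i)\<^sup>2))"
    unfolding wp by (rule real_le_rsqrt) (simp add: Cauchy_Schwarz_ineq_sum)
  then show ?thesis unfolding WW dual_form_sum_squares by (simp add: real_sqrt_mult)
qed

text \<open>Evaluates the definite description behind \<open>ginv\<close>. The frame relation makes
  \<open>H\<close> a right inverse of \<open>G\<close>, symmetry makes it a left inverse, and any
  left inverse \<open>h\<close> satisfies \<open>h = h (G H) = (h G) H = H\<close>. Requiring zero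
  outside \<open>B\<close> makes \<open>h\<close> unique as a function.\<close>

lemma dual_form_unique_inverse:
  fixes G E :: "'i \<Rightarrow> 'i \<Rightarrow> real"
  assumes B: "finite B"
    and sym: "\<And>i j. i \<in> B \<Longrightarrow> j \<in> B \<Longrightarrow> G i j = G j i"
    and E: "\<And>k i. k \<in> B \<Longrightarrow> i \<in> B \<Longrightarrow>
      (\<Sum>a\<in>B. (\<Sum>j\<in>B. G k j * E a j) * E a i) = (if k = i then 1 else 0)"
  shows "(THE h. (\<forall>i j. i \<notin> B \<or> j \<notin> B \<longrightarrow> h i j = 0) \<and>
      (\<forall>i\<in>B. \<forall>j\<in>B. (\<Sum>k\<in>B. h i k * G k j) = (if i = j then 1 else 0))) =
    (\<lambda>i j. if i \<in> B \<and> j \<in> B then \<Sum>a\<in>B. E a i * E a j else 0)"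
proof -
  define H where "H i j = (if i \<in> B \<and> j \<in> B then \<Sum>a\<in>B. E a i * E a j else 0)" for i j
  have GH: "(\<Sum>l\<in>B. G k l * H l i) = (if k = i then 1 else 0)" if "k \<in> B" "i \<in> B" for k i
  proof -
    have "(\<Sum>l\<in>B. G k l * H l i) = (\<Sum>l\<in>B. \<Sum>a\<in>B. G k l * E a l * E a i)"
      using that by (intro sum.cong) (auto simp: H_def sum_distrib_left algebra_simps)
    also have "\<dots> = (\<Sum>a\<in>B. \<Sum>l\<in>B. G k l * E a l * E a i)" by (rule sum.swap)
    finally show ?thesis using E[OF that] by (simp add: sum_distrib_right)
  qed
  have Hsym: "H i j = H j i" for i j by (auto simp: H_def mult.commute)
  have HG: "(\<Sum>k\<in>B. H i k * G k j) = (if i = j then 1 else 0)" if "i \<in> B" "j \<in> B" for i j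
  proof -
    have "(\<Sum>k\<in>B. H i k * G k j) = (\<Sum>k\<in>B. G j k * H k i)"
      using that by (intro sum.cong refl) (simp add: sym[of _ j] Hsym[of i] mult.commute)
    then show ?thesis using GH[OF that(2,1)] by (simp add: eq_commute)
  qed
  have "(THE h. (\<forall>i j. i \<notin> B \<or> j \<notin> B \<longrightarrow> h i j = 0) \<and>
      (\<forall>i\<in>B. \<forall>j\<in>B. (\<Sum>k\<in>B. h i k * G k j) = (if i = j then 1 else 0))) = H"
  proof (rule the_equality, goal_cases)
    case 1
    show ?case using HG by (auto simp: H_def)
  next
    case (2 h)
    show "h = H"
    proof (intro ext)
      fix i j
      show "h i j = H i j"
      proof (cases "i \<in> B \<and> j \<in> B")
        case True
        have "h i j = (\<Sum>k\<in>B. if k = j then h i k else 0)" using True B by simp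
        also have "\<dots> = (\<Sum>k\<in>B. h i k * (\<Sum>l\<in>B. G k l * H l j))"
          using True by (intro sum.cong refl) (simp only: GH, simp)
        also have "\<dots> = (\<Sum>k\<in>B. \<Sum>l\<in>B. h i k * G k l * H l j)"
          by (simp only: sum_distrib_left mult.assoc)
        also have "\<dots> = (\<Sum>l\<in>B. (\<Sum>k\<in>B. h i k * G k l) * H l j)"
          by (subst sum.swap) (simp only: sum_distrib_right)
        also have "\<dots> = (\<Sum>l\<in>B. if l = i then H l j else 0)"
          using True 2 by (intro sum.cong refl) auto
        also have "\<dots> = H i j" using True B by simp
        finally show ?thesis .
      next
        case False
        then show ?thesis using 2 by (auto simp: H_def)
      qed
    qed
  qed
  also have "H = (\<lambda>i j. if i \<in> B \<and> j \<in> B then \<Sum>a\<in>B. E a i * E a j else 0)"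
    by (intro ext) (simp add: H_def)
  finally show ?thesis .
qed

section \<open>Tensor powers of a Gram form\<close>

lemma sum_lists_Suc:
  fixes F :: "'i list \<Rightarrow> real"
  shows "(\<Sum>J\<in>{J. set J \<subseteq> B \<and> length J = Suc n}. F J) =
    (\<Sum>i\<in>B. \<Sum>J\<in>{J. set J \<subseteq> B \<and> length J = n}. F (i # J))"
proof -
  have "{J. set J \<subseteq> B \<and> length J = Suc n} =
      (\<lambda>(i, J). i # J) ` (B \<times> {J. set J \<subseteq> B \<and> length J = n})"
    by (auto simp: image_iff length_Suc_conv)
  moreover have "inj_on (\<lambda>(i, J). i # J) (B \<times> {J. set J \<subseteq> B \<and> length J = n})"
    by (auto simp: inj_on_def)
  ultimately show ?thesis
    by (simp add: sum.reindex sum.cartesian_product split_def o_def)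
qed

text \<open>The form induced on tensors of order \<open>n\<close> is again a Gram form: multiplying
  out the product of sums gives one term for each word \<open>K\<close> of frame indices, and that
  term factors into a part in \<open>I\<close> and a part in \<open>J\<close>.\<close>

lemma tensor_power_Gram:
  fixes E :: "'i \<Rightarrow> 'i \<Rightarrow> real"
  assumes "length I = n" "length J = n"
  shows "(\<Prod>l<n. \<Sum>a\<in>B. E a (I ! l) * E a (J ! l)) =
    (\<Sum>K\<in>{K. set K \<subseteq> B \<and> length K = n}. (\<Prod>l<n. E (K ! l) (I ! l)) * (\<Prod>l<n. E (K ! l) (J ! l)))"
  using assms
proof (induction n arbitrary: I J)
  case 0
  have "{K. set K \<subseteq> B \<and> length K = 0} = {[]}" by auto
  then show ?case by simp
next
  case (Suc n)
  then obtain i I' j J' where *: "I = i # I'" "J = j # J'" "length I' = n" "length J' = n"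
    by (metis length_Suc_conv)
  show ?case
    unfolding sum_lists_Suc
    using Suc.IH[OF *(3,4)]
    by (simp add: * prod.lessThan_Suc_shift sum_product algebra_simps del: prod.lessThan_Suc)
qed

lemma tensor_power_form_nonneg:
  fixes E :: "'i \<Rightarrow> 'i \<Rightarrow> real"
  assumes "L = {J. set J \<subseteq> B \<and> length J = n}"
  shows "(\<Sum>I\<in>L. \<Sum>J\<in>L. (\<Prod>l<n. \<Sum>a\<in>B. E a (I ! l) * E a (J ! l)) * v I * v J) \<ge> 0"
proof -
  let ?P = "\<lambda>K I. \<Prod>l<n. E (K ! l) (I ! l)"
  have "(\<Sum>I\<in>L. \<Sum>J\<in>L. (\<Prod>l<n. \<Sum>a\<in>B. E a (I ! l) * E a (J ! l)) * v I * v J) =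
      (\<Sum>I\<in>L. \<Sum>J\<in>L. \<Sum>K\<in>L. (?P K I * v I) * (?P K J * v J))"
    by (intro sum.cong refl)
      (auto simp: assms tensor_power_Gram sum_distrib_left mult.assoc mult.commute mult.left_commute)
  also have "\<dots> = (\<Sum>I\<in>L. \<Sum>K\<in>L. \<Sum>J\<in>L. (?P K I * v I) * (?P K J * v J))"
    by (intro sum.cong refl sum.swap)
  also have "\<dots> = (\<Sum>K\<in>L. \<Sum>I\<in>L. \<Sum>J\<in>L. (?P K I * v I) * (?P K J * v J))"
    by (rule sum.swap)
  also have "\<dots> = (\<Sum>K\<in>L. (\<Sum>I\<in>L. ?P K I * v I)\<^sup>2)"
    by (simp add: power2_eq_square sum_product)
  finally show ?thesis by (simp add: sum_nonneg)
qed


section \<open>Differentiability of functions with continuous partial derivatives\<close>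

lemma Ck_on_imp_continuous_on: "Ck_on B k V F \<Longrightarrow> continuous_on V F"
  by (cases k) auto

text \<open>\<open>Ck_on\<close> provides derivatives at parameter 0 only. Rebasing the line at
  \<open>y + s *\<^sub>R b\<close> moves the parameter to \<open>s\<close>; only this point has to
  lie in \<open>V\<close>.\<close>

lemma Ck_on_Suc_has_derivative_line:
  assumes "Ck_on B (Suc k) V F" "b \<in> B" "y + s *\<^sub>R b \<in> V"
  shows "((\<lambda>t. F (y + t *\<^sub>R b)) has_real_derivative pderiv_at b F (y + s *\<^sub>R b)) (at s)"
proof -
  have "(\<lambda>t. F ((y + s *\<^sub>R b) + t *\<^sub>R b)) field_differentiable (at 0)"
    using assms by auto
  then have "((\<lambda>t. F ((y + s *\<^sub>R b) + t *\<^sub>R b)) has_real_derivative pderiv_at b F (y + s *\<^sub>R b)) (at 0)"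
    by (simp add: pderiv_at_def DERIV_deriv_iff_field_differentiable)
  moreover have "(\<lambda>t. F ((y + s *\<^sub>R b) + t *\<^sub>R b)) = (\<lambda>t. F (y + (t + s) *\<^sub>R b))"
    by (simp add: algebra_simps)
  ultimately show ?thesis using DERIV_shift[of "\<lambda>t. F (y + t *\<^sub>R b)" _ 0 s] by simp
qed

lemma euclidean_representation_span:
  fixes w :: "'e::euclidean_space"
  assumes B: "B \<subseteq> Basis" and w: "w \<in> span B"
  shows "(\<Sum>b\<in>B. (w \<bullet> b) *\<^sub>R b) = w"
proof (rule euclidean_eqI)
  fix c :: 'e assume c: "c \<in> Basis"
  have finB: "finite B" using B by (rule finite_subset) simp
  have "(\<Sum>b\<in>B. (w \<bullet> b) *\<^sub>R b) \<bullet> c = (\<Sum>b\<in>B. if b = c then w \<bullet> c else 0)"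
    unfolding inner_sum_left using B c by (intro sum.cong) (auto simp: inner_Basis)
  also have "\<dots> = w \<bullet> c"
  proof (cases "c \<in> B")
    case False
    have "orthogonal c w"
    proof (rule orthogonal_to_span[OF w])
      fix z assume "z \<in> B"
      then show "orthogonal c z" using B c False by (auto simp: orthogonal_def inner_Basis)
    qed
    then show ?thesis using False finB by (simp add: orthogonal_def inner_commute)
  qed (use finB in simp)
  finally show "(\<Sum>b\<in>B. (w \<bullet> b) *\<^sub>R b) \<bullet> c = w \<bullet> c" .
qed

text \<open>Continuous partial derivatives give total differentiability: pass from \<open>y\<close>
  to \<open>w\<close> changing one coordinate at a time, and apply the mean value theorem on each
  edge. The derivative is taken within \<open>span B\<close>, the model space in which
  \<open>V\<close> is open.\<close>

lemma Ck_on_Suc_has_derivative: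
  fixes F :: "'e::euclidean_space \<Rightarrow> real"
  assumes B: "B \<subseteq> Basis" and V: "openin (top_of_set (span B)) V"
    and F: "Ck_on B (Suc k) V F" and y: "y \<in> V"
  shows "(F has_derivative (\<lambda>w. \<Sum>b\<in>B. (w \<bullet> b) * pderiv_at b F y)) (at y within span B)"
  unfolding has_derivative_within_alt
proof (intro conjI allI impI)
  have finB: "finite B" using B by (rule finite_subset) simp
  show "bounded_linear (\<lambda>w. \<Sum>b\<in>B. (w \<bullet> b) * pderiv_at b F y)"
    by (intro bounded_linear_sum bounded_linear_mult_left[THEN bounded_linear_compose]
        bounded_linear_inner_left)
  fix e :: real assume e: "e > 0"
  \<comment> \<open>The error \<open>e'\<close> is spent once per coordinate; the added 1 avoids a
    division by zero when \<open>B\<close> is empty.\<close>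
  define e' where "e' = e / (card B + 1)"
  have e': "e' > 0" using e by (simp add: e'_def add_pos_nonneg)
  have "\<forall>b\<in>B. \<forall>\<^sub>F z in at y within V. dist (pderiv_at b F z) (pderiv_at b F y) < e'"
  proof
    fix b assume "b \<in> B"
    then have "continuous_on V (pderiv_at b F)"
      using F by (intro Ck_on_imp_continuous_on[of B k]) simp
    then have "(pderiv_at b F \<longlongrightarrow> pderiv_at b F y) (at y within V)"
      using y by (simp add: continuous_on_def)
    then show "\<forall>\<^sub>F z in at y within V. dist (pderiv_at b F z) (pderiv_at b F y) < e'"
      using e' by (rule tendstoD)
  qed
  then have "\<forall>\<^sub>F z in at y within V. \<forall>b\<in>B. dist (pderiv_at b F z) (pderiv_at b F y) < e'"
    by (rule eventually_ball_finite[OF finB])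
  then obtain d1 where d1: "d1 > 0"
    "\<And>z b. z \<in> V \<Longrightarrow> dist z y < d1 \<Longrightarrow> b \<in> B \<Longrightarrow> dist (pderiv_at b F z) (pderiv_at b F y) < e'"
    unfolding eventually_at using e' by (metis dist_self)
  obtain d2 where d2: "d2 > 0" "ball y d2 \<inter> span B \<subseteq> V"
    using V y unfolding openin_contains_ball by blast
  have ySp: "y \<in> span B" using V y openin_imp_subset by blast
  show "\<exists>d>0. \<forall>w\<in>span B. norm (w - y) < d \<longrightarrow>
    norm (F w - F y - (\<Sum>b\<in>B. ((w - y) \<bullet> b) * pderiv_at b F y)) \<le> e * norm (w - y)"
  proof (intro exI[of _ "min d1 d2"] conjI ballI impI)
    show "min d1 d2 > 0" using d1 d2 by simp
    fix w assume w: "w \<in> span B" "norm (w - y) < min d1 d2"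
    define \<tau> where "\<tau> b = (w - y) \<bullet> b" for b
    define Z where "Z T = y + (\<Sum>b\<in>T. \<tau> b *\<^sub>R b)" for T
    \<comment> \<open>Each coordinate of a point on the path deviates from that of \<open>y\<close>
      by no more than the same coordinate of \<open>w\<close> does, so the path stays in every ball
      about \<open>y\<close> that contains \<open>w\<close>.\<close>
    have near: "Z T + s *\<^sub>R b \<in> V" "dist (Z T + s *\<^sub>R b) y < d1"
      if T: "T \<subseteq> B" "b \<in> B" "b \<notin> T" and s: "\<bar>s\<bar> \<le> \<bar>\<tau> b\<bar>" for T b s
    proof -
      have fT: "finite T" using T finB finite_subset by blast
      have "norm (Z T + s *\<^sub>R b - y) \<le> norm (w - y)"
      proof (rule norm_le_componentwise)
        fix c :: 'e assume c: "c \<in> Basis"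
        have "(\<Sum>x\<in>T. \<tau> x * (x \<bullet> c)) = (\<Sum>x\<in>T. if x = c then \<tau> c else 0)"
          using T B c by (intro sum.cong) (auto simp: inner_Basis)
        moreover have "b \<bullet> c = (if b = c then 1 else 0)" using T B c by (auto simp: inner_Basis)
        ultimately have "(Z T + s *\<^sub>R b - y) \<bullet> c = (if c \<in> T then \<tau> c else 0) + (if b = c then s else 0)"
          using fT by (simp add: Z_def inner_add_left inner_diff_left inner_sum_left)
        then show "\<bar>(Z T + s *\<^sub>R b - y) \<bullet> c\<bar> \<le> \<bar>(w - y) \<bullet> c\<bar>"
          using T s by (auto simp: \<tau>_def)
      qed
      then have *: "dist (Z T + s *\<^sub>R b) y < min d1 d2" using w by (simp add: dist_norm)
      then show "dist (Z T + s *\<^sub>R b) y < d1" by simp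
      have "Z T + s *\<^sub>R b \<in> span B"
        unfolding Z_def using T ySp
        by (intro span_add span_sum span_scale) (auto intro: span_base)
      then show "Z T + s *\<^sub>R b \<in> V" using d2 * by (auto simp: dist_commute)
    qed
    have "\<bar>F (Z T) - F y - (\<Sum>b\<in>T. \<tau> b * pderiv_at b F y)\<bar> \<le> e' * (\<Sum>b\<in>T. \<bar>\<tau> b\<bar>)"
      if "T \<subseteq> B" for T
      using finite_subset[OF that finB] that
    proof (induction T rule: finite_induct)
      case empty
      then show ?case by (simp add: Z_def)
    next
      case (insert b T)
      \<comment> \<open>Scaling the edge to the unit interval treats both signs of
        \<open>\<tau> b\<close> alike. The linear term is subtracted in advance, so that the mean
        value theorem yields the error directly.\<close>
      let ?u = "\<lambda>s. F (Z T + (s * \<tau> b) *\<^sub>R b) - s * \<tau> b * pderiv_at b F y"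
      let ?u' = "\<lambda>s. pderiv_at b F (Z T + (s * \<tau> b) *\<^sub>R b) * \<tau> b - \<tau> b * pderiv_at b F y"
      have st: "\<bar>s * \<tau> b\<bar> \<le> \<bar>\<tau> b\<bar>" if "0 \<le> s" "s \<le> 1" for s
        using that mult_right_mono[of s 1 "\<bar>\<tau> b\<bar>"] by (simp add: abs_mult)
      have der: "(?u has_real_derivative ?u' s) (at s)" if "0 \<le> s" "s \<le> 1" for s
      proof -
        have "((\<lambda>t. F (Z T + t *\<^sub>R b)) has_real_derivative
            pderiv_at b F (Z T + (s * \<tau> b) *\<^sub>R b)) (at (s * \<tau> b))"
          using insert near[of T b "s * \<tau> b"] st[OF that]
          by (intro Ck_on_Suc_has_derivative_line[OF F]) auto
        then have "((\<lambda>s. F (Z T + (s * \<tau> b) *\<^sub>R b)) has_real_derivative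
            pderiv_at b F (Z T + (s * \<tau> b) *\<^sub>R b) * \<tau> b) (at s)"
          by (rule DERIV_chain2) (auto intro!: derivative_eq_intros)
        then show ?thesis by (auto intro!: derivative_eq_intros)
      qed
      obtain \<xi> where \<xi>: "0 < \<xi>" "\<xi> < 1" "?u 1 - ?u 0 = (1 - 0) * ?u' \<xi>"
        using MVT2[of 0 1 ?u ?u'] der by auto
      have "dist (pderiv_at b F (Z T + (\<xi> * \<tau> b) *\<^sub>R b)) (pderiv_at b F y) < e'"
        using insert near[of T b "\<xi> * \<tau> b"] st[of \<xi>] \<xi> d1 by auto
      then have "\<bar>\<tau> b\<bar> * \<bar>pderiv_at b F (Z T + (\<xi> * \<tau> b) *\<^sub>R b) - pderiv_at b F y\<bar> \<le> \<bar>\<tau> b\<bar> * e'"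
        by (intro mult_left_mono) (auto simp: dist_real_def)
      then have "\<bar>?u' \<xi>\<bar> \<le> e' * \<bar>\<tau> b\<bar>"
        by (simp add: abs_mult[symmetric] algebra_simps)
      moreover have "Z (insert b T) = Z T + \<tau> b *\<^sub>R b"
        using insert by (simp add: Z_def)
      ultimately have "\<bar>F (Z (insert b T)) - F (Z T) - \<tau> b * pderiv_at b F y\<bar> \<le> e' * \<bar>\<tau> b\<bar>"
        using \<xi>(3) by simp
      then show ?case using insert by (simp add: algebra_simps)
    qed
    from this[OF order_refl]
    have "\<bar>F (Z B) - F y - (\<Sum>b\<in>B. \<tau> b * pderiv_at b F y)\<bar> \<le> e' * (\<Sum>b\<in>B. \<bar>\<tau> b\<bar>)" .
    also have "(\<Sum>b\<in>B. \<bar>\<tau> b\<bar>) \<le> (\<Sum>b\<in>B. norm (w - y))"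
      using B by (intro sum_mono) (auto simp: \<tau>_def Basis_le_norm)
    also have "e' * (\<Sum>b\<in>B. norm (w - y)) \<le> e * norm (w - y)"
      using e by (simp add: e'_def field_simps)
    also have "Z B = w"
    proof -
      have wy: "w - y \<in> span B" using w(1) ySp by (rule span_diff)
      have "w - y = (\<Sum>b\<in>B. \<tau> b *\<^sub>R b)"
        using euclidean_representation_span[OF B wy] by (simp add: \<tau>_def)
      then show ?thesis by (simp add: Z_def algebra_simps)
    qed
    finally show "norm (F w - F y - (\<Sum>b\<in>B. ((w - y) \<bullet> b) * pderiv_at b F y)) \<le> e * norm (w - y)"
      using e' by (simp add: \<tau>_def mult_left_mono)
  qed
qed


section \<open>Chart calculus\<close>

context smooth_manifold
begin

lemma finite_coords: "finite B"
  using coords by (rule finite_subset) simp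

lemma cdom_subset: "c \<in> A \<Longrightarrow> cdom c \<subseteq> topspace M"
  using chart_domain openin_subset by blast

lemma topspace_cdom: "c \<in> A \<Longrightarrow> topspace (subtopology M (cdom c)) = cdom c"
  using cdom_subset[of c] by (simp add: Int_absorb1)

lemma cmap_inj: "c \<in> A \<Longrightarrow> inj_on (cmap c) (cdom c)"
  using chart_homeo[of c] topspace_cdom[of c] homeomorphic_imp_injective_map by metis

lemma cinv_cmap: "c \<in> A \<Longrightarrow> x \<in> cdom c \<Longrightarrow> cinv c (cmap c x) = x"
  using cmap_inj by (simp add: cinv_def)

lemma cmap_cinv: "y \<in> cmap c ` cdom c \<Longrightarrow> cmap c (cinv c y) = y"
  by (simp add: cinv_def f_inv_into_f)

lemma cinv_in_cdom: "y \<in> cmap c ` cdom c \<Longrightarrow> cinv c y \<in> cdom c"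
  by (simp add: cinv_def inv_into_into)

lemma chart_range_subset: "c \<in> A \<Longrightarrow> cmap c ` cdom c \<subseteq> span B"
  using chart_range openin_imp_subset by blast

lemma continuous_map_cmap:
  "c \<in> A \<Longrightarrow> continuous_map (subtopology M (cdom c)) (top_of_set (cmap c ` cdom c)) (cmap c)"
  using chart_homeo homeomorphic_imp_continuous_map by blast

lemma continuous_map_cinv:
  assumes c: "c \<in> A"
  shows "continuous_map (top_of_set (cmap c ` cdom c)) M (cinv c)"
proof -
  obtain k where k: "homeomorphic_maps (subtopology M (cdom c)) (top_of_set (cmap c ` cdom c)) (cmap c) k"
    using chart_homeo[OF c] unfolding homeomorphic_map_maps by blast
  then have "continuous_map (top_of_set (cmap c ` cdom c)) M k"
    unfolding homeomorphic_maps_def by (blast dest: continuous_map_into_fulltopology)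
  moreover have "k y = cinv c y" if "y \<in> cmap c ` cdom c" for y
    using that k topspace_cdom[OF c] cinv_cmap[OF c] unfolding homeomorphic_maps_def by auto
  ultimately show ?thesis by (rule continuous_map_eq) simp
qed

lemma openin_cmap_image:
  assumes c: "c \<in> A" and U: "openin M U" "U \<subseteq> cdom c"
  shows "openin (top_of_set (span B)) (cmap c ` U)"
proof -
  have "openin (subtopology M (cdom c)) U"
    using U by (simp add: openin_open_subtopology chart_domain c)
  then have "openin (top_of_set (cmap c ` cdom c)) (cmap c ` U)"
    using homeomorphic_imp_open_map[OF chart_homeo[OF c]] by (simp add: open_map_def)
  then show ?thesis using chart_range[OF c] by (metis openin_trans)
qed

lemma Cp_chart: "f \<in> Cp p \<Longrightarrow> c \<in> A \<Longrightarrow> Ck_on B p (cmap c ` cdom c) (f \<circ> cinv c)"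
  by (simp add: Cp_def)

lemma continuous_map_Cp:
  assumes f: "f \<in> Cp p"
  shows "continuous_map M euclideanreal f"
proof (rule pasting_lemma[where I = A and T = cdom and f = "\<lambda>c. f"])
  fix c assume c: "c \<in> A"
  have "continuous_map (top_of_set (cmap c ` cdom c)) euclideanreal (f \<circ> cinv c)"
    using Ck_on_imp_continuous_on[OF Cp_chart[OF f c]] by simp
  then have "continuous_map (subtopology M (cdom c)) euclideanreal ((f \<circ> cinv c) \<circ> cmap c)"
    by (rule continuous_map_compose[OF continuous_map_cmap[OF c]])
  then show "continuous_map (subtopology M (cdom c)) euclideanreal f"
    by (rule continuous_map_eq) (use cinv_cmap[OF c] topspace_cdom[OF c] in auto)
next
  fix x assume "x \<in> topspace M"
  then show "\<exists>c. c \<in> A \<and> x \<in> cdom c \<and> f x = f x" using chart_cover by blast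
qed (use chart_domain in auto)

lemma chart_line_in_range:
  assumes c: "c \<in> A" and U: "openin M U" "U \<subseteq> cdom c" "x \<in> U" and b: "b \<in> B"
  obtains e where "e > 0" "\<And>t. \<bar>t\<bar> < e \<Longrightarrow> cmap c x + t *\<^sub>R b \<in> cmap c ` U"
proof -
  obtain e where e: "e > 0" "ball (cmap c x) e \<inter> span B \<subseteq> cmap c ` U"
    using openin_cmap_image[OF c U(1,2)] U(3) unfolding openin_contains_ball by blast
  have "cmap c x + t *\<^sub>R b \<in> cmap c ` U" if "\<bar>t\<bar> < e" for t
  proof -
    have "cmap c x \<in> span B" using chart_range_subset[OF c] U by auto
    then have "cmap c x + t *\<^sub>R b \<in> span B" using b by (simp add: span_add span_scale span_base)
    moreover have "norm b = 1" using b coords by auto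
    ultimately show ?thesis using e that by (auto simp: dist_norm)
  qed
  with that e(1) show thesis by blast
qed

lemma has_derivative_chart_line:
  assumes f: "f \<in> Cp (Suc p)" and c: "c \<in> A" and x: "x \<in> cdom c" and b: "b \<in> B"
  shows "((\<lambda>t. f (cinv c (cmap c x + t *\<^sub>R b))) has_real_derivative chart_pderiv c b f x) (at 0)"
  using Ck_on_Suc_has_derivative_line[OF Cp_chart[OF f c] b, of "cmap c x" 0] x
  by (simp add: chart_pderiv_def)

text \<open>Seen in the chart \<open>d\<close>, a coordinate line of \<open>c\<close> becomes a
  curve \<open>\<gamma>\<close> that is in general not straight. The chain rule along it therefore
  requires the total derivative from \<open>Ck_on_Suc_has_derivative\<close>, not just partial
  derivatives.\<close>

lemma chart_pderiv_change:
  assumes f: "f \<in> Cp (Suc p)" and c: "c \<in> A" and d: "d \<in> A" and x: "x \<in> cdom c \<inter> cdom d"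
    and i: "i \<in> B"
  shows "chart_pderiv c i f x =
    (\<Sum>k\<in>B. chart_pderiv c i (\<lambda>z. cmap d z \<bullet> k) x * chart_pderiv d k f x)"
proof -
  define y where "y = cmap c x"
  define \<gamma> where "\<gamma> t = cmap d (cinv c (y + t *\<^sub>R i))" for t
  define D where "D k = chart_pderiv c i (\<lambda>z. cmap d z \<bullet> k) x" for k
  have opn: "openin M (cdom c \<inter> cdom d)" using chart_domain c d by blast
  obtain e where e: "e > 0" and line: "\<And>t. \<bar>t\<bar> < e \<Longrightarrow> y + t *\<^sub>R i \<in> cmap c ` (cdom c \<inter> cdom d)"
    using chart_line_in_range[OF c opn _ x i] unfolding y_def by blast
  have in_d: "cinv c (y + t *\<^sub>R i) \<in> cdom d" if "\<bar>t\<bar> < e" for t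
    using line[OF that] cinv_cmap[OF c] by auto
  have \<gamma>0: "\<gamma> 0 = cmap d x" using cinv_cmap[OF c] x by (simp add: \<gamma>_def y_def)
  have D: "((\<lambda>t. \<gamma> t \<bullet> k) has_real_derivative D k) (at 0)" if k: "k \<in> B" for k
  proof -
    have "Ck_on B (Suc 0) (cmap c ` (cdom c \<inter> cdom d)) (\<lambda>y. cmap d (cinv c y) \<bullet> k)"
      using chart_transition[OF c d k] unfolding smooth_on_def by blast
    from Ck_on_Suc_has_derivative_line[OF this i, of y 0] show ?thesis
      using line[of 0] e by (simp add: \<gamma>_def D_def chart_pderiv_def y_def o_def)
  qed
  have \<gamma>span: "\<gamma> t \<in> span B" if "t \<in> {-e<..<e}" for t
    using in_d[of t] that chart_range_subset[OF d] by (auto simp: \<gamma>_def)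
  have "((\<lambda>t. \<Sum>k\<in>B. (\<gamma> t \<bullet> k) *\<^sub>R k) has_derivative (\<lambda>s. \<Sum>k\<in>B. (s * D k) *\<^sub>R k)) (at 0)"
    using D by (intro has_derivative_sum has_derivative_scaleR_left)
      (simp add: has_field_derivative_def mult.commute[of _ "D _"] mult_commute_abs)
  then have "((\<lambda>t. \<Sum>k\<in>B. (\<gamma> t \<bullet> k) *\<^sub>R k) has_derivative (\<lambda>s. \<Sum>k\<in>B. (s * D k) *\<^sub>R k))
      (at 0 within {-e<..<e})"
    by (rule has_derivative_at_withinI)
  \<comment> \<open>\<open>\<gamma>\<close> is known to lie in \<open>span B\<close>, and hence to
    equal its expansion in \<open>B\<close>, only for parameters smaller than \<open>e\<close>; the
    restriction to this interval is lifted at the end, as it is open.\<close>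
  then have der\<gamma>: "(\<gamma> has_derivative (\<lambda>s. \<Sum>k\<in>B. (s * D k) *\<^sub>R k)) (at 0 within {-e<..<e})"
    by (rule has_derivative_transform[rotated 2])
      (use e euclidean_representation_span[OF coords \<gamma>span] in auto)
  have "(f \<circ> cinv d has_derivative (\<lambda>w. \<Sum>b\<in>B. (w \<bullet> b) * chart_pderiv d b f x)) (at (\<gamma> 0) within span B)"
    using Ck_on_Suc_has_derivative[OF coords chart_range[OF d] Cp_chart[OF f d], of "\<gamma> 0"] x
    by (simp add: \<gamma>0 chart_pderiv_def)
  then have "(f \<circ> cinv d has_derivative (\<lambda>w. \<Sum>b\<in>B. (w \<bullet> b) * chart_pderiv d b f x))
      (at (\<gamma> 0) within \<gamma> ` {-e<..<e})"
    by (rule has_derivative_subset) (use \<gamma>span in auto)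
  from has_derivative_in_compose[OF der\<gamma> this]
  have "((\<lambda>t. (f \<circ> cinv d) (\<gamma> t)) has_derivative
      (\<lambda>s. \<Sum>b\<in>B. ((\<Sum>k\<in>B. (s * D k) *\<^sub>R k) \<bullet> b) * chart_pderiv d b f x)) (at 0 within {-e<..<e})" .
  moreover have "(\<Sum>k\<in>B. (s * D k) *\<^sub>R k) \<bullet> b = s * D b" if "b \<in> B" for s b
  proof -
    have "k \<bullet> b = (if k = b then 1 else 0)" if "k \<in> B" for k
      using \<open>b \<in> B\<close> that coords by (metis inner_Basis subsetD)
    then have "(\<Sum>k\<in>B. (s * D k) *\<^sub>R k) \<bullet> b = (\<Sum>k\<in>B. if k = b then s * D b else 0)"
      unfolding inner_sum_left by (intro sum.cong) auto
    then show ?thesis using that finite_coords by simp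
  qed
  ultimately have "((\<lambda>t. (f \<circ> cinv d) (\<gamma> t)) has_derivative
      (\<lambda>s. (\<Sum>b\<in>B. D b * chart_pderiv d b f x) * s)) (at 0 within {-e<..<e})"
    by (simp add: sum_distrib_left mult.assoc mult.commute mult.left_commute cong: sum.cong)
  then have "((\<lambda>t. (f \<circ> cinv d) (\<gamma> t)) has_real_derivative
      (\<Sum>b\<in>B. D b * chart_pderiv d b f x)) (at 0)"
    using e by (simp add: has_field_derivative_def at_within_open[of 0 "{-e<..<e}"])
  then have "((\<lambda>t. f (cinv c (y + t *\<^sub>R i))) has_real_derivative
      (\<Sum>b\<in>B. D b * chart_pderiv d b f x)) (at 0)"
    by (rule DERIV_cong_ev[THEN iffD1, rotated 3])
      (use e in_d cinv_cmap[OF d] in \<open>auto simp: eventually_nhds \<gamma>_def intro!: exI[of _ "{-e<..<e}"]\<close>)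
  then show ?thesis
    using DERIV_unique[OF has_derivative_chart_line[OF f c, of x i]] x i
    by (simp add: y_def D_def)
qed

end


section \<open>Control of first derivatives by the Levi-Civita norms\<close>

context riemannian_manifold
begin

lemma ginv_frame:
  assumes c: "c \<in> A" and x: "x \<in> cdom c"
  shows "\<exists>E. (\<forall>k\<in>B. \<forall>i\<in>B.
      (\<Sum>a\<in>B. (\<Sum>j\<in>B. g c k j x * E a j) * E a i) = (if k = i then 1 else 0)) \<and>
    (\<forall>i\<in>B. \<forall>j\<in>B. ginv c i j x = (\<Sum>a\<in>B. E a i * E a j))"
proof -
  have sym: "\<And>i j. i \<in> B \<Longrightarrow> j \<in> B \<Longrightarrow> g c i j x = g c j i x"
    by (rule metric_sym[OF c _ _ x])
  have pos: "\<And>v. \<exists>i\<in>B. v i \<noteq> 0 \<Longrightarrow> (\<Sum>i\<in>B. \<Sum>j\<in>B. g c i j x * v i * v j) > 0"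
    by (rule metric_pos[OF c x])
  have "\<exists>E. \<forall>k\<in>B. \<forall>i\<in>B.
      (\<Sum>a\<in>B. (\<Sum>j\<in>B. g c k j x * E a j) * E a i) = (if k = i then 1 else 0)"
    by (rule pos_def_frame_exists) (fact finite_coords sym pos)+
  then obtain E where E: "\<And>k i. k \<in> B \<Longrightarrow> i \<in> B \<Longrightarrow>
      (\<Sum>a\<in>B. (\<Sum>j\<in>B. g c k j x * E a j) * E a i) = (if k = i then 1 else 0)"
    by blast
  have "ginv c i j x = (\<Sum>a\<in>B. E a i * E a j)" if "i \<in> B" "j \<in> B" for i j
    unfolding ginv_def
    by (subst dual_form_unique_inverse[where E = E]) (fact finite_coords sym E | use that in simp)+
  with E show ?thesis by blast
qed

text \<open>As \<open>sqrt\<close> is negative on negative reals, this needs the form on tensors to be positive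
  semidefinite. It allows the terms of order at least two to be dropped from the strong norm.\<close>

lemma nabla_norm_in_nonneg:
  assumes c: "c \<in> A" and x: "x \<in> cdom c"
  shows "0 \<le> nabla_norm_in c i f x"
proof -
  obtain E where E: "\<And>i j. i \<in> B \<Longrightarrow> j \<in> B \<Longrightarrow> ginv c i j x = (\<Sum>a\<in>B. E a i * E a j)"
    using ginv_frame[OF c x] by blast
  have "(\<Prod>l<i. ginv c (I ! l) (J ! l) x) = (\<Prod>l<i. \<Sum>a\<in>B. E a (I ! l) * E a (J ! l))"
    if "I \<in> multi_indices i" "J \<in> multi_indices i" for I J
  proof (rule prod.cong)
    fix l assume "l \<in> {..<i}"
    then have "I ! l \<in> B" "J ! l \<in> B"
      using that nth_mem unfolding multi_indices_def by auto
    then show "ginv c (I ! l) (J ! l) x = (\<Sum>a\<in>B. E a (I ! l) * E a (J ! l))" by (rule E)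
  qed simp
  then have "(\<Sum>I\<in>multi_indices i. \<Sum>J\<in>multi_indices i.
        (\<Prod>l<i. ginv c (I ! l) (J ! l) x) * nabla c f I x * nabla c f J x) =
      (\<Sum>I\<in>multi_indices i. \<Sum>J\<in>multi_indices i.
        (\<Prod>l<i. \<Sum>a\<in>B. E a (I ! l) * E a (J ! l)) * nabla c f I x * nabla c f J x)"
    by (intro sum.cong refl) simp
  also have "\<dots> \<ge> 0" by (rule tensor_power_form_nonneg) (rule multi_indices_def)
  finally show ?thesis by (simp add: nabla_norm_in_def)
qed

lemma some_chart:
  assumes "x \<in> topspace M"
  shows "(SOME c. c \<in> A \<and> x \<in> cdom c) \<in> A" "x \<in> cdom (SOME c. c \<in> A \<and> x \<in> cdom c)"
proof -
  have "\<exists>c. c \<in> A \<and> x \<in> cdom c" using assms chart_cover by blast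
  from someI_ex[OF this] show "(SOME c. c \<in> A \<and> x \<in> cdom c) \<in> A"
    "x \<in> cdom (SOME c. c \<in> A \<and> x \<in> cdom c)" by auto
qed

lemma nabla_norm_nonneg: "x \<in> topspace M \<Longrightarrow> 0 \<le> nabla_norm i f x"
  unfolding nabla_norm_def using some_chart by (intro nabla_norm_in_nonneg) auto

lemma nabla_norm_0: "nabla_norm 0 f x = \<bar>f x\<bar>"
proof -
  have "multi_indices 0 = {[]}" by (auto simp: multi_indices_def)
  then show ?thesis by (simp add: nabla_norm_def nabla_norm_in_def)
qed

text \<open>In order one no connection term appears: the Christoffel sum runs over an empty list of
  remaining indices.\<close>

lemma nabla_norm_in_1:
  "nabla_norm_in c 1 f x =
    sqrt (\<Sum>i\<in>B. \<Sum>j\<in>B. ginv c i j x * chart_pderiv c i f x * chart_pderiv c j f x)"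
proof -
  have "{J. set J \<subseteq> B \<and> length J = 0} = {[]}" by auto
  then show ?thesis
    unfolding nabla_norm_in_def multi_indices_def One_nat_def sum_lists_Suc by simp
qed

text \<open>\<open>fun_diff\<close> is a genuine difference only on \<open>M\<close>, and
  \<open>cinv c\<close> is meaningful only on the chart range. The two functions are therefore
  compared for small parameters, which is enough for a derivative at 0.\<close>

lemma chart_pderiv_fun_diff:
  assumes h: "h \<in> Cp (Suc p)" and f: "f \<in> Cp (Suc p)" and c: "c \<in> A" and x: "x \<in> cdom c" and i: "i \<in> B"
  shows "chart_pderiv c i (fun_diff h f) x = chart_pderiv c i h x - chart_pderiv c i f x"
proof -
  obtain e where e: "e > 0" and line: "\<And>t. \<bar>t\<bar> < e \<Longrightarrow> cmap c x + t *\<^sub>R i \<in> cmap c ` cdom c"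
    using chart_line_in_range[OF c chart_domain[OF c] order_refl x i] by blast
  have "((\<lambda>t. h (cinv c (cmap c x + t *\<^sub>R i)) - f (cinv c (cmap c x + t *\<^sub>R i)))
      has_real_derivative chart_pderiv c i h x - chart_pderiv c i f x) (at 0)"
    by (intro DERIV_diff has_derivative_chart_line[OF h c x i] has_derivative_chart_line[OF f c x i])
  moreover have "\<forall>\<^sub>F t in nhds 0. h (cinv c (cmap c x + t *\<^sub>R i)) - f (cinv c (cmap c x + t *\<^sub>R i)) =
      fun_diff h f (cinv c (cmap c x + t *\<^sub>R i))"
    unfolding eventually_nhds_metric
  proof (intro exI[of _ e] conjI allI impI)
    fix t :: real assume "dist t 0 < e"
    then have "cinv c (cmap c x + t *\<^sub>R i) \<in> topspace M"
      using cinv_in_cdom[OF line[of t]] cdom_subset[OF c] by (auto simp: dist_real_def)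
    then show "h (cinv c (cmap c x + t *\<^sub>R i)) - f (cinv c (cmap c x + t *\<^sub>R i)) =
      fun_diff h f (cinv c (cmap c x + t *\<^sub>R i))" by (simp add: fun_diff_def)
  qed (rule e)
  ultimately have "((\<lambda>t. fun_diff h f (cinv c (cmap c x + t *\<^sub>R i)))
      has_real_derivative chart_pderiv c i h x - chart_pderiv c i f x) (at 0)"
    using DERIV_cong_ev[OF refl] by fastforce
  then show ?thesis
    unfolding chart_pderiv_def[of c i "fun_diff h f"] pderiv_at_def by (simp add: DERIV_imp_deriv)
qed

text \<open>Bounding the differential of \<open>h - f\<close> in every chart by the metric on vectors, rather than
  through \<open>nabla_norm\<close>, makes the triangle inequality immediate; it is what gives open neighbourhoods
  below without showing that balls for the full \<open>C\<^sup>p\<close> norm are open.\<close>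

definition C1_near :: "real \<Rightarrow> ('a \<Rightarrow> real) \<Rightarrow> ('a \<Rightarrow> real) \<Rightarrow> 'a \<Rightarrow> bool" where
  "C1_near r h f x \<longleftrightarrow> \<bar>h x - f x\<bar> \<le> r \<and> (\<forall>c\<in>A. x \<in> cdom c \<longrightarrow>
     (\<forall>v. \<bar>\<Sum>i\<in>B. v i * (chart_pderiv c i h x - chart_pderiv c i f x)\<bar>
        \<le> r * sqrt (\<Sum>i\<in>B. \<Sum>j\<in>B. g c i j x * v i * v j)))"

lemma metric_form_nonneg:
  assumes "c \<in> A" "x \<in> cdom c"
  shows "0 \<le> (\<Sum>i\<in>B. \<Sum>j\<in>B. g c i j x * v i * v j)"
proof (cases "\<exists>i\<in>B. v i \<noteq> 0")
  case True
  then show ?thesis using metric_pos[OF assms] by (auto intro: less_imp_le)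
qed simp

lemma C1_near_refl: "C1_near 0 f f x"
  by (simp add: C1_near_def)

lemma C1_near_mono:
  assumes n: "C1_near r h f x" and rs: "r \<le> s"
  shows "C1_near s h f x"
  unfolding C1_near_def
proof (intro conjI ballI impI allI)
  show "\<bar>h x - f x\<bar> \<le> s" using n rs unfolding C1_near_def by linarith
  fix c v assume c: "c \<in> A" "x \<in> cdom c"
  have "\<bar>\<Sum>i\<in>B. v i * (chart_pderiv c i h x - chart_pderiv c i f x)\<bar>
      \<le> r * sqrt (\<Sum>i\<in>B. \<Sum>j\<in>B. g c i j x * v i * v j)"
    using n c unfolding C1_near_def by blast
  also have "\<dots> \<le> s * sqrt (\<Sum>i\<in>B. \<Sum>j\<in>B. g c i j x * v i * v j)"
    using rs metric_form_nonneg[OF c] by (intro mult_right_mono) auto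
  finally show "\<bar>\<Sum>i\<in>B. v i * (chart_pderiv c i h x - chart_pderiv c i f x)\<bar>
      \<le> s * sqrt (\<Sum>i\<in>B. \<Sum>j\<in>B. g c i j x * v i * v j)" .
qed

lemma C1_near_trans:
  assumes hk: "C1_near r h k x" and kf: "C1_near s k f x"
  shows "C1_near (r + s) h f x"
  unfolding C1_near_def
proof (intro conjI ballI impI allI)
  show "\<bar>h x - f x\<bar> \<le> r + s" using hk kf unfolding C1_near_def by linarith
  fix c v assume c: "c \<in> A" "x \<in> cdom c"
  let ?S = "\<lambda>h f. \<Sum>i\<in>B. v i * (chart_pderiv c i h x - chart_pderiv c i f x)"
  let ?n = "sqrt (\<Sum>i\<in>B. \<Sum>j\<in>B. g c i j x * v i * v j)"
  have "?S h f = ?S h k + ?S k f"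
    by (simp add: sum.distrib[symmetric] algebra_simps)
  moreover have "\<bar>?S h k\<bar> \<le> r * ?n" "\<bar>?S k f\<bar> \<le> s * ?n"
    using hk kf c unfolding C1_near_def by blast+
  ultimately have "\<bar>?S h f\<bar> \<le> r * ?n + s * ?n" by linarith
  then show "\<bar>?S h f\<bar> \<le> (r + s) * ?n" by (simp add: distrib_right)
qed

text \<open>\<open>nabla_norm\<close> is computed in one selected chart \<open>d\<close>, while
  \<open>C1_near\<close> concerns every chart \<open>c\<close>. The Jacobian carries
  \<open>v\<close> to \<open>w\<close>; by the transformation laws of differential and metric, the
  pairing with \<open>h - f\<close> and the length of the vector are unchanged. Cauchy-Schwarz in
  \<open>d\<close> then bounds the pairing.\<close>

lemma C1_near_if_nabla_norm_le:
  assumes h: "h \<in> Cp (Suc p)" and f: "f \<in> Cp (Suc p)" and x: "x \<in> topspace M"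
    and n0: "nabla_norm 0 (fun_diff h f) x \<le> r" and n1: "nabla_norm 1 (fun_diff h f) x \<le> r"
  shows "C1_near r h f x"
  unfolding C1_near_def
proof (intro conjI ballI impI allI)
  show "\<bar>h x - f x\<bar> \<le> r" using n0 x by (simp add: nabla_norm_0 fun_diff_def)
  fix c v assume c: "c \<in> A" and xc: "x \<in> cdom c"
  define d where "d = (SOME c. c \<in> A \<and> x \<in> cdom c)"
  have d: "d \<in> A" "x \<in> cdom d" using some_chart[OF x] by (simp_all add: d_def)
  define Dd where "Dd i k = chart_pderiv c i (\<lambda>z. cmap d z \<bullet> k) x" for i k
  define w where "w k = (\<Sum>i\<in>B. v i * Dd i k)" for k
  define p where "p k = chart_pderiv d k (fun_diff h f) x" for k
  have p: "p k = chart_pderiv d k h x - chart_pderiv d k f x" if "k \<in> B" for k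
    unfolding p_def by (rule chart_pderiv_fun_diff[OF h f d that])
  have "(\<Sum>i\<in>B. v i * (chart_pderiv c i h x - chart_pderiv c i f x)) =
      (\<Sum>i\<in>B. v i * (\<Sum>k\<in>B. Dd i k * p k))"
    using c d xc
    by (intro sum.cong refl)
      (simp add: chart_pderiv_change[OF h c d(1)] chart_pderiv_change[OF f c d(1)] Dd_def p
        right_diff_distrib sum_subtractf)
  also have "\<dots> = (\<Sum>i\<in>B. \<Sum>k\<in>B. v i * Dd i k * p k)"
    by (simp add: sum_distrib_left mult.assoc)
  also have "\<dots> = (\<Sum>k\<in>B. w k * p k)"
    unfolding w_def sum_distrib_right by (rule sum.swap)
  finally have eq: "(\<Sum>i\<in>B. v i * (chart_pderiv c i h x - chart_pderiv c i f x)) = (\<Sum>k\<in>B. w k * p k)" .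
  have "(\<Sum>i\<in>B. \<Sum>j\<in>B. g c i j x * v i * v j) =
      (\<Sum>i\<in>B. \<Sum>j\<in>B. (\<Sum>k\<in>B. \<Sum>l\<in>B. g d k l x * Dd i k * Dd j l) * v i * v j)"
    using c d xc by (intro sum.cong refl) (simp add: metric_transform[OF c d(1)] Dd_def)
  also have "\<dots> = (\<Sum>i\<in>B. \<Sum>j\<in>B. \<Sum>k\<in>B. \<Sum>l\<in>B. g d k l x * (v i * Dd i k) * (v j * Dd j l))"
    by (simp add: sum_distrib_left mult.assoc mult.commute mult.left_commute)
  also have "\<dots> = (\<Sum>i\<in>B. \<Sum>k\<in>B. \<Sum>j\<in>B. \<Sum>l\<in>B. g d k l x * (v i * Dd i k) * (v j * Dd j l))"
    by (intro sum.cong refl sum.swap)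
  also have "\<dots> = (\<Sum>k\<in>B. \<Sum>i\<in>B. \<Sum>j\<in>B. \<Sum>l\<in>B. g d k l x * (v i * Dd i k) * (v j * Dd j l))"
    by (rule sum.swap)
  also have "\<dots> = (\<Sum>k\<in>B. \<Sum>i\<in>B. \<Sum>l\<in>B. \<Sum>j\<in>B. g d k l x * (v i * Dd i k) * (v j * Dd j l))"
    by (intro sum.cong refl sum.swap)
  also have "\<dots> = (\<Sum>k\<in>B. \<Sum>l\<in>B. \<Sum>i\<in>B. \<Sum>j\<in>B. g d k l x * (v i * Dd i k) * (v j * Dd j l))"
    by (intro sum.cong refl sum.swap)
  also have "\<dots> = (\<Sum>k\<in>B. \<Sum>l\<in>B. g d k l x * w k * w l)"
    by (simp add: w_def sum_product sum_distrib_left mult.assoc mult.commute mult.left_commute)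
  finally have gw: "(\<Sum>i\<in>B. \<Sum>j\<in>B. g c i j x * v i * v j) = (\<Sum>k\<in>B. \<Sum>l\<in>B. g d k l x * w k * w l)" .
  obtain E where E: "\<And>k i. k \<in> B \<Longrightarrow> i \<in> B \<Longrightarrow>
      (\<Sum>a\<in>B. (\<Sum>j\<in>B. g d k j x * E a j) * E a i) = (if k = i then 1 else 0)"
    and gE: "\<And>i j. i \<in> B \<Longrightarrow> j \<in> B \<Longrightarrow> ginv d i j x = (\<Sum>a\<in>B. E a i * E a j)"
    using ginv_frame[OF d] by blast
  have "sqrt (\<Sum>i\<in>B. \<Sum>j\<in>B. (\<Sum>a\<in>B. E a i * E a j) * p i * p j) = nabla_norm 1 (fun_diff h f) x"
    unfolding nabla_norm_def d_def[symmetric] nabla_norm_in_1 p_def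
    by (intro arg_cong[of _ _ sqrt] sum.cong refl) (simp add: gE)
  then have "\<bar>\<Sum>k\<in>B. w k * p k\<bar> \<le>
      sqrt (\<Sum>i\<in>B. \<Sum>j\<in>B. g d i j x * w i * w j) * nabla_norm 1 (fun_diff h f) x"
    using dual_form_Cauchy_Schwarz[OF finite_coords, of "\<lambda>i j. g d i j x" E w p] E by simp
  also have "\<dots> \<le> sqrt (\<Sum>i\<in>B. \<Sum>j\<in>B. g d i j x * w i * w j) * r"
    using n1 metric_form_nonneg[OF d] by (intro mult_left_mono) auto
  finally show "\<bar>\<Sum>i\<in>B. v i * (chart_pderiv c i h x - chart_pderiv c i f x)\<bar>
      \<le> r * sqrt (\<Sum>i\<in>B. \<Sum>j\<in>B. g c i j x * v i * v j)"
    unfolding eq gw by (simp add: mult.commute)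
qed

end


section \<open>Decreasing homotopies\<close>

lemma homotopic_self_deformation:
  assumes T: "continuous_map (prod_topology (top_of_set {0..1::real}) M) M T"
    and T0: "\<And>x. x \<in> topspace M \<Longrightarrow> T (0, x) = x"
    and P: "P \<subseteq> topspace M" "\<And>t x. t \<in> {0..1} \<Longrightarrow> x \<in> P \<Longrightarrow> T (t, x) \<in> P"
  shows "homotopic_with (\<lambda>_. True) (subtopology M P) (subtopology M P)
    ((\<lambda>x. T (1, x)) \<circ> (\<lambda>x. T (1, x))) id"
proof -
  let ?X = "prod_topology (top_of_set {0..1::real}) (subtopology M P)"
  have X: "?X = subtopology (prod_topology (top_of_set {0..1}) M) ({0..1} \<times> P)"
    by (simp add: subtopology_Times subtopology_subtopology)
  have topX: "topspace ?X = {0..1} \<times> P" using P by (auto simp: topspace_subtopology_subset)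
  have T': "continuous_map ?X (subtopology M P) T"
    unfolding X continuous_map_in_subtopology
    using T P by (auto intro: continuous_map_from_subtopology)
  have "continuous_map ?X ?X (\<lambda>z. (fst z, T z))"
    by (intro continuous_map_pairedI continuous_map_fst T')
  from continuous_map_compose[OF this T']
  have "continuous_map ?X (subtopology M P) (\<lambda>z. T (fst z, T z))" by (simp add: o_def)
  then have "homotopic_with (\<lambda>_. True) (subtopology M P) (subtopology M P) id
    ((\<lambda>x. T (1, x)) \<circ> (\<lambda>x. T (1, x)))"
    using P T0 by (subst homotopic_with) (auto intro!: exI[of _ "\<lambda>z. T (fst z, T z)"])
  then show ?thesis by (rule homotopic_with_symD)
qed

lemma homotopy_equivalent_by_common_deformation:
  assumes T: "continuous_map (prod_topology (top_of_set {0..1::real}) M) M T"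
    and T0: "\<And>x. x \<in> topspace M \<Longrightarrow> T (0, x) = x"
    and P: "P \<subseteq> topspace M" "\<And>t x. t \<in> {0..1} \<Longrightarrow> x \<in> P \<Longrightarrow> T (t, x) \<in> P"
    and Q: "Q \<subseteq> topspace M" "\<And>t x. t \<in> {0..1} \<Longrightarrow> x \<in> Q \<Longrightarrow> T (t, x) \<in> Q"
    and PQ: "\<And>x. x \<in> P \<Longrightarrow> T (1, x) \<in> Q"
    and QP: "\<And>x. x \<in> Q \<Longrightarrow> T (1, x) \<in> P"
  shows "subtopology M P homotopy_equivalent_space subtopology M Q"
proof -
  have "continuous_map M (prod_topology (top_of_set {0..1::real}) M) (\<lambda>x. (1, x))"
    by (intro continuous_map_pairedI) auto
  from continuous_map_compose[OF this T]
  have T1: "continuous_map M M (\<lambda>x. T (1, x))" by (simp add: o_def)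
  have "continuous_map (subtopology M P) (subtopology M Q) (\<lambda>x. T (1, x))"
    "continuous_map (subtopology M Q) (subtopology M P) (\<lambda>x. T (1, x))"
    using T1 PQ QP by (auto simp: continuous_map_in_subtopology continuous_map_from_subtopology)
  then show ?thesis
    unfolding homotopy_equivalent_space_def
    using homotopic_self_deformation[OF T T0 P] homotopic_self_deformation[OF T T0 Q] by blast
qed

section \<open>Pushes along a fixed direction in a chart\<close>

context smooth_manifold
begin

text \<open>The bump is the tent of height and radius \<open>r\<close> about \<open>y\<close>. As
  its height at a point is the remaining distance to the sphere of radius \<open>r\<close>, a unit
  vector \<open>v\<close> never carries a point across that sphere.\<close>

definition chart_push :: "('a, 'e) chart \<Rightarrow> 'e \<Rightarrow> real \<Rightarrow> 'e \<Rightarrow> real \<times> 'a \<Rightarrow> 'a" where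
  "chart_push c y r v = (\<lambda>(t, x). if x \<in> cdom c
     then cinv c (cmap c x + (t * max 0 (r - dist (cmap c x) y)) *\<^sub>R v) else x)"

text \<open>If \<open>s > 0\<close>, then \<open>z\<close> is closer to \<open>y\<close> than
  \<open>r\<close> and moves by at most the difference, so it remains within distance
  \<open>r\<close>. Otherwise \<open>s = 0\<close> and nothing moves. The radius
  \<open>3 * r\<close> leaves a margin around the closed ball of radius \<open>r\<close>.\<close>

lemma chart_push_line_in_range:
  assumes V: "ball y (3 * r) \<inter> span B \<subseteq> V" and z: "z \<in> V" "z \<in> span B"
    and v: "v \<in> span B" "norm v = 1" and s: "0 \<le> s" "s \<le> max 0 (r - dist z y)"
  shows "z + s *\<^sub>R v \<in> V" "s > 0 \<Longrightarrow> z + s *\<^sub>R v \<in> ball y (3 * r)"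
proof -
  show *: "z + s *\<^sub>R v \<in> ball y (3 * r)" if "s > 0"
  proof -
    have "dist (z + s *\<^sub>R v) y \<le> norm (z - y) + norm (s *\<^sub>R v)"
      unfolding dist_norm using norm_triangle_ineq[of "z - y" "s *\<^sub>R v"] by (simp add: algebra_simps)
    also have "\<dots> < 3 * r"
    proof -
      have "s \<le> r - norm (z - y)" using that s by (auto simp: dist_norm max_def split: if_splits)
      then have "norm (z - y) + s < 3 * r" using that norm_ge_zero[of "z - y"] by linarith
      then show ?thesis using that v by simp
    qed
    finally show ?thesis by (simp add: dist_commute)
  qed
  have "z + s *\<^sub>R v \<in> span B" using z v by (simp add: span_add span_scale)
  with * show "z + s *\<^sub>R v \<in> V" using V z s by (cases "s > 0") auto
qed

text \<open>Two open sets cover \<open>M\<close>: the chart domain, where the formula is continuous,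
  and the complement of \<open>K\<close>, where the push is the identity. \<open>K\<close> is the
  image of a compact set, hence closed because \<open>M\<close> is Hausdorff; the two descriptions
  agree on the overlap because the tent vanishes outside the ball.\<close>

lemma continuous_map_chart_push:
  assumes c: "c \<in> A" and r: "r > 0" and V: "ball y (3 * r) \<inter> span B \<subseteq> cmap c ` cdom c"
    and v: "v \<in> span B" "norm v = 1"
  shows "continuous_map (prod_topology (top_of_set {0..1}) M) M (chart_push c y r v)"
proof -
  let ?I = "top_of_set {0..1::real}" and ?V = "cmap c ` cdom c"
  define K where "K = cinv c ` (cball y r \<inter> span B)"
  have "cball y r \<inter> span B \<subseteq> ball y (3 * r) \<inter> span B" using r by auto
  then have KV: "cball y r \<inter> span B \<subseteq> ?V" using V by blast
  have "compact (cball y r \<inter> span B)" by (intro compact_Int_closed) (simp_all add: closed_span)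
  then have "compactin (top_of_set ?V) (cball y r \<inter> span B)"
    using KV by (simp add: compactin_subtopology)
  then have "compactin M K"
    unfolding K_def by (rule image_compactin) (rule continuous_map_cinv[OF c])
  then have K: "openin M (topspace M - K)" using compactin_imp_closedin[OF Hausdorff] by blast
  define q where "q = (\<lambda>(t, z). z + (t * max 0 (r - dist z y)) *\<^sub>R v)"
  have q: "continuous_map (top_of_set ({0..1} \<times> ?V)) (top_of_set ?V) q"
  proof -
    have "continuous_on ({0..1} \<times> ?V) q"
      unfolding q_def split_def by (intro continuous_intros)
    moreover have "q (t, z) \<in> ?V" if "t \<in> {0..1}" "z \<in> ?V" for t z
    proof -
      have "t * max 0 (r - dist z y) \<le> 1 * max 0 (r - dist z y)"
        using that by (intro mult_right_mono) auto
      then show ?thesis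
        unfolding q_def prod.case using that chart_range_subset[OF c] v
        by (intro chart_push_line_in_range(1)[OF V]) auto
    qed
    ultimately show ?thesis by (auto simp: continuous_map_in_subtopology)
  qed
  have "continuous_map (prod_topology ?I (subtopology M (cdom c))) (prod_topology ?I (top_of_set ?V))
      (\<lambda>(t, x). (t, cmap c x))"
    unfolding continuous_map_prod_top using continuous_map_cmap[OF c] by simp
  from continuous_map_compose[OF this, of "top_of_set ?V" q] q
  have "continuous_map (prod_topology ?I (subtopology M (cdom c))) (top_of_set ?V)
      (q \<circ> (\<lambda>(t, x). (t, cmap c x)))" by simp
  from continuous_map_compose[OF this continuous_map_cinv[OF c]]
  have push: "continuous_map (subtopology (prod_topology ?I M) ({0..1} \<times> cdom c)) M
      (cinv c \<circ> (q \<circ> (\<lambda>(t, x). (t, cmap c x))))"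
    by (simp add: subtopology_Times subtopology_subtopology)
  show ?thesis
  proof (rule pasting_lemma[where I = UNIV and T = "\<lambda>i. {0..1} \<times> (if i then cdom c else topspace M - K)"
        and f = "\<lambda>i. if i then cinv c \<circ> (q \<circ> (\<lambda>(t, x). (t, cmap c x))) else snd"])
    fix i :: bool
    show "openin (prod_topology ?I M) ({0..1} \<times> (if i then cdom c else topspace M - K))"
      using K chart_domain[OF c] by (simp add: openin_prod_Times_iff)
    show "continuous_map (subtopology (prod_topology ?I M) ({0..1} \<times> (if i then cdom c else topspace M - K))) M
        (if i then cinv c \<circ> (q \<circ> (\<lambda>(t, x). (t, cmap c x))) else snd)"
      using push by (auto intro: continuous_map_from_subtopology continuous_map_snd)
  next
    have *: "cinv c (q (t, cmap c x)) = x" if "x \<in> cdom c" "x \<notin> K" for t x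
    proof -
      have "cmap c x \<notin> cball y r"
        using that chart_range_subset[OF c] cinv_cmap[OF c] unfolding K_def image_iff by force
      then show ?thesis using that cinv_cmap[OF c] by (simp add: q_def dist_commute)
    qed
    fix i j x assume "x \<in> topspace (prod_topology ?I M) \<inter>
      ({0..1} \<times> (if i then cdom c else topspace M - K)) \<inter> ({0..1} \<times> (if j then cdom c else topspace M - K))"
    then show "(if i then cinv c \<circ> (q \<circ> (\<lambda>(t, x). (t, cmap c x))) else snd) x =
      (if j then cinv c \<circ> (q \<circ> (\<lambda>(t, x). (t, cmap c x))) else snd) x"
      using * by (cases x) (auto split: if_splits)
  next
    have K_cdom: "x \<in> cdom c" if "x \<in> K" for x
      using that cinv_in_cdom[OF subsetD[OF KV]] unfolding K_def by (elim imageE) simp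
    fix x assume "x \<in> topspace (prod_topology ?I M)"
    then show "\<exists>i. i \<in> UNIV \<and> x \<in> {0..1} \<times> (if i then cdom c else topspace M - K) \<and>
        chart_push c y r v x = (if i then cinv c \<circ> (q \<circ> (\<lambda>(t, x). (t, cmap c x))) else snd) x"
      using K_cdom by (cases x, intro exI[of _ "snd x \<in> cdom c"]) (auto simp: chart_push_def q_def)
  qed
qed

end

context riemannian_manifold
begin

lemma C1_near_chart_pderiv:
  assumes n: "C1_near r h f x" and c: "c \<in> A" "x \<in> cdom c" and b: "b \<in> B"
  shows "\<bar>chart_pderiv c b h x - chart_pderiv c b f x\<bar> \<le> r * sqrt (g c b b x)"
proof -
  define v where "v i = (if i = b then 1 else 0 :: real)" for i
  have 1: "(\<Sum>i\<in>B. v i * F i) = F b" for F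
    using b finite_coords by (simp add: v_def of_bool_def[symmetric] if_distrib[of "\<lambda>x. x * _"] cong: if_cong)
  have "(\<Sum>i\<in>B. \<Sum>j\<in>B. g c i j x * v i * v j) = (\<Sum>i\<in>B. v i * (\<Sum>j\<in>B. v j * g c i j x))"
    by (simp add: sum_distrib_left mult.assoc mult.commute mult.left_commute)
  also have "\<dots> = g c b b x" by (simp add: 1)
  finally have gb: "(\<Sum>i\<in>B. \<Sum>j\<in>B. g c i j x * v i * v j) = g c b b x" .
  have "\<bar>\<Sum>i\<in>B. v i * (chart_pderiv c i h x - chart_pderiv c i f x)\<bar>
      \<le> r * sqrt (\<Sum>i\<in>B. \<Sum>j\<in>B. g c i j x * v i * v j)"
    using n c unfolding C1_near_def by blast
  then show ?thesis unfolding gb 1 .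
qed

text \<open>The alternative ``\<open>x\<close> is fixed or \<open>f\<close> strictly decreases'' is what makes the strictness on \<open>U\<close>
  survive composition.\<close>

definition descent ::
    "nat \<Rightarrow> real \<Rightarrow> ('a \<Rightarrow> real) \<Rightarrow> (real \<times> 'a \<Rightarrow> 'a) \<Rightarrow> 'a set \<Rightarrow> bool" where
  "descent p \<delta> f T U \<longleftrightarrow> \<delta> > 0 \<and>
     continuous_map (prod_topology (top_of_set {0..1}) M) M T \<and>
     (\<forall>x\<in>topspace M. T (0, x) = x) \<and>
     (\<forall>h\<in>Cp p. (\<forall>x\<in>topspace M. C1_near \<delta> h f x) \<longrightarrow>
        (\<forall>t\<in>{0..1}. \<forall>x\<in>topspace M. h (T (t, x)) \<le> h x)) \<and>
     (\<forall>x\<in>topspace M. T (1, x) = x \<or> f (T (1, x)) < f x) \<and>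
     (\<forall>x\<in>U. x \<in> topspace M \<and> f (T (1, x)) < f x)"

lemma local_descent:
  assumes f: "f \<in> Cp (Suc p)" and dx: "differential_nonzero f x0"
  shows "\<exists>U T \<delta>. openin M U \<and> x0 \<in> U \<and> descent (Suc p) \<delta> f T U"
proof -
  obtain c b where c: "c \<in> A" and x0: "x0 \<in> cdom c" and b: "b \<in> B" and nz: "chart_pderiv c b f x0 \<noteq> 0"
    using dx unfolding differential_nonzero_def by blast
  let ?V = "cmap c ` cdom c"
  define y0 where "y0 = cmap c x0"
  define p0 where "p0 = pderiv_at b (f \<circ> cinv c) y0"
  define \<sigma> where "\<sigma> = - sgn p0"
  \<comment> \<open>The slope \<open>p0\<close> is shared out: one half of
    \<open>\<bar>p0\<bar>\<close> covers the variation of the slope of \<open>f\<close> near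
    \<open>y0\<close>, the other half covers replacing \<open>f\<close> by \<open>h\<close>. The
    latter costs at most \<open>\<delta> * sqrt G\<close>, which explains the choice
    \<open>\<delta> = m / sqrt G\<close> below.\<close>
  define m where "m = \<bar>p0\<bar> / 2"
  \<comment> \<open>An upper bound, near \<open>x0\<close>, for the squared length of the coordinate
    vector \<open>b\<close>; the 1 is the tolerance used in the continuity estimate.\<close>
  define G where "G = g c b b x0 + 1"
  have p0: "p0 \<noteq> 0" using nz by (simp add: p0_def y0_def chart_pderiv_def)
  have \<sigma>: "\<bar>\<sigma>\<bar> = 1" "\<sigma> * p0 = - \<bar>p0\<bar>" using p0 abs_sgn[of p0] by (simp_all add: \<sigma>_def abs_sgn_eq mult.commute)
  have m: "m > 0" using p0 by (simp add: m_def)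
  have y0: "y0 \<in> ?V" using x0 by (simp add: y0_def)
  have gpos: "0 < g c b b x" if "x \<in> cdom c" for x
    using metric_pos[OF c that, of "\<lambda>i. if i = b then 1 else 0"] b finite_coords
    by (simp add: if_distrib[of "\<lambda>z. _ * z"] cong: if_cong)
  have G: "G > 0" using gpos[OF x0] by (simp add: G_def)
  have "continuous_on ?V (pderiv_at b (f \<circ> cinv c))"
    using Cp_chart[OF f c] b by (intro Ck_on_imp_continuous_on[of B p]) simp
  then have "\<forall>\<^sub>F z in at y0 within ?V. dist (pderiv_at b (f \<circ> cinv c) z) p0 < m"
    using y0 m unfolding continuous_on_def p0_def by (blast intro: tendstoD)
  moreover have "continuous_on ?V (g c b b \<circ> cinv c)"
    using metric_smooth[OF c b b] unfolding smooth_on_def by (blast intro: Ck_on_imp_continuous_on)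
  then have "\<forall>\<^sub>F z in at y0 within ?V. dist ((g c b b \<circ> cinv c) z) ((g c b b \<circ> cinv c) y0) < 1"
    using y0 unfolding continuous_on_def by (blast intro: tendstoD zero_less_one)
  ultimately have "\<forall>\<^sub>F z in at y0 within ?V. dist (pderiv_at b (f \<circ> cinv c) z) p0 < m \<and>
      dist ((g c b b \<circ> cinv c) z) ((g c b b \<circ> cinv c) y0) < 1"
    by (rule eventually_conj)
  then obtain d1 where d1: "d1 > 0" "\<And>z. z \<in> ?V \<Longrightarrow> z \<noteq> y0 \<Longrightarrow> dist z y0 < d1 \<Longrightarrow>
      dist (pderiv_at b (f \<circ> cinv c) z) p0 < m \<and>
      dist ((g c b b \<circ> cinv c) z) ((g c b b \<circ> cinv c) y0) < 1"
    unfolding eventually_at by blast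
  \<comment> \<open>The estimates obtained from \<open>eventually_at\<close> omit the centre
    \<open>y0\<close>, which is treated separately.\<close>
  have near: "\<bar>pderiv_at b (f \<circ> cinv c) z - p0\<bar> < m" "g c b b (cinv c z) \<le> G"
    if "z \<in> ?V" "dist z y0 < d1" for z
    using d1(2)[OF that(1) _ that(2)] m cinv_cmap[OF c x0]
    by (cases "z = y0"; force simp: dist_real_def p0_def G_def y0_def)+
  obtain d2 where d2: "d2 > 0" "ball y0 d2 \<inter> span B \<subseteq> ?V"
    using chart_range[OF c] y0 unfolding openin_contains_ball by blast
  define r where "r = min d1 d2 / 3"
  have r: "r > 0" "3 * r \<le> d1" "3 * r \<le> d2" using d1 d2 by (auto simp: r_def)
  have rV: "ball y0 (3 * r) \<inter> span B \<subseteq> ?V" using d2 r by auto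
  define v where "v = \<sigma> *\<^sub>R b"
  have v: "v \<in> span B" "norm v = 1"
    using b \<sigma> coords by (auto simp: v_def span_scale span_base)
  define T where "T = chart_push c y0 r v"
  define \<delta> where "\<delta> = m / sqrt G"
  have \<delta>: "\<delta> > 0" using m G by (simp add: \<delta>_def)
  have dec: "h (T (t, x)) < h x" if h: "h \<in> Cp (Suc p)" "\<And>x. x \<in> topspace M \<Longrightarrow> C1_near \<delta> h f x"
    and t: "t \<in> {0..1}" and x: "x \<in> cdom c" and pos: "t * max 0 (r - dist (cmap c x) y0) > 0" for h t x
  proof -
    let ?s = "t * max 0 (r - dist (cmap c x) y0)"
    let ?H = "h \<circ> cinv c"
    have s_le: "?s \<le> max 0 (r - dist (cmap c x) y0)"
      using t by (intro mult_left_le_one_le) auto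
    have xV: "cmap c x \<in> ?V" "cmap c x \<in> span B" using x chart_range_subset[OF c] by auto
    have rpos: "r - dist (cmap c x) y0 > 0"
      using pos t by (auto simp: zero_less_mult_iff max_def split: if_splits)
    have neg: "\<sigma> * pderiv_at b ?H z < 0" if z: "z \<in> ?V" "z \<in> ball y0 (3 * r)" for z
    proof -
      have zd: "dist z y0 < d1" using z r by (auto simp: dist_commute)
      have "\<bar>chart_pderiv c b h (cinv c z) - chart_pderiv c b f (cinv c z)\<bar> \<le> \<delta> * sqrt (g c b b (cinv c z))"
        using z cinv_in_cdom[OF z(1)] cdom_subset[OF c]
        by (intro C1_near_chart_pderiv[OF h(2) c _ b]) auto
      also have "\<dots> \<le> \<delta> * sqrt G" using near(2)[OF z(1) zd] \<delta> by (intro mult_left_mono) auto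
      also have "\<dots> = m" using G by (simp add: \<delta>_def)
      finally have "\<bar>pderiv_at b ?H z - pderiv_at b (f \<circ> cinv c) z\<bar> \<le> m"
        using cmap_cinv[OF z(1)] by (simp add: chart_pderiv_def)
      with near(1)[OF z(1) zd] have "\<bar>pderiv_at b ?H z - p0\<bar> < \<bar>p0\<bar>"
        unfolding m_def by linarith
      then have "\<bar>\<sigma> * (pderiv_at b ?H z - p0)\<bar> < \<bar>p0\<bar>" using \<sigma> by (simp add: abs_mult)
      then show ?thesis using \<sigma>(2) by (simp add: right_diff_distrib)
    qed
    \<comment> \<open>The parameter is the distance travelled. Membership in the ball, and with it
      the sign of the derivative, is available for positive parameters; the monotonicity rule asks
      for it on the open interval only.\<close>
    have "?H (cmap c x + (?s * \<sigma>) *\<^sub>R b) < ?H (cmap c x + (0 * \<sigma>) *\<^sub>R b)"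
    proof (rule DERIV_neg_imp_decreasing_open[OF pos])
      have *: "cmap c x + (s * \<sigma>) *\<^sub>R b \<in> ?V" "s > 0 \<Longrightarrow> cmap c x + (s * \<sigma>) *\<^sub>R b \<in> ball y0 (3 * r)"
        if "0 \<le> s" "s \<le> ?s" for s
        using chart_push_line_in_range[OF rV xV v that(1)] that(2) s_le
        by (auto simp: v_def)
      have der: "((\<lambda>s. ?H (cmap c x + (s * \<sigma>) *\<^sub>R b)) has_real_derivative
            pderiv_at b ?H (cmap c x + (s * \<sigma>) *\<^sub>R b) * \<sigma>) (at s)" if "0 \<le> s" "s \<le> ?s" for s
      proof (rule DERIV_chain2[where f = "\<lambda>t. ?H (cmap c x + t *\<^sub>R b)" and g = "\<lambda>s. s * \<sigma>"])
        show "((\<lambda>t. ?H (cmap c x + t *\<^sub>R b)) has_real_derivative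
            pderiv_at b ?H (cmap c x + (s * \<sigma>) *\<^sub>R b)) (at (s * \<sigma>))"
          by (rule Ck_on_Suc_has_derivative_line[OF Cp_chart[OF h(1) c] b *(1)[OF that]])
      qed (auto intro!: derivative_eq_intros)
      show "continuous_on {0..?s} (\<lambda>s. ?H (cmap c x + (s * \<sigma>) *\<^sub>R b))"
        using der by (intro DERIV_atLeastAtMost_imp_continuous_on) auto
      fix s assume s: "0 < s" "s < ?s"
      show "\<exists>d. ((\<lambda>s. ?H (cmap c x + (s * \<sigma>) *\<^sub>R b)) has_real_derivative d) (at s) \<and> d < 0"
      proof (intro exI conjI)
        show "pderiv_at b ?H (cmap c x + (s * \<sigma>) *\<^sub>R b) * \<sigma> < 0"
          using neg[OF *] s by (metis less_imp_le mult.commute)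
      qed (use der s in auto)
    qed
    then show ?thesis using x cinv_cmap[OF c x] by (simp add: T_def chart_push_def v_def)
  qed
  have fix_pt: "T (t, x) = x" if "\<not> (x \<in> cdom c \<and> t * max 0 (r - dist (cmap c x) y0) > 0)" "t \<in> {0..1}" for t x
  proof (cases "x \<in> cdom c")
    case True
    then have "t * max 0 (r - dist (cmap c x) y0) = 0"
      using that by (intro antisym) (auto simp: mult_nonneg_nonneg not_less)
    then show ?thesis
      unfolding T_def chart_push_def prod.case
      by (simp only: True if_True scaleR_zero_left add_0_right cinv_cmap[OF c True])
  qed (simp add: T_def chart_push_def)
  have ff: "C1_near \<delta> f f x" for x using C1_near_mono[OF C1_near_refl] \<delta> by simp
  \<comment> \<open>Exactly the points where the tent is positive, so each of them really moves at
    time 1.\<close>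
  define U where "U = {x \<in> cdom c. cmap c x \<in> ball y0 r}"
  have "openin (subtopology M (cdom c)) {x \<in> topspace (subtopology M (cdom c)). cmap c x \<in> ?V \<inter> ball y0 r}"
    by (rule openin_continuous_map_preimage[OF continuous_map_cmap[OF c]]) (simp add: openin_open_Int)
  moreover have "{x \<in> topspace (subtopology M (cdom c)). cmap c x \<in> ?V \<inter> ball y0 r} = U"
    using topspace_cdom[OF c] by (auto simp: U_def)
  ultimately have U: "openin M U"
    using chart_domain[OF c] openin_trans_full by metis
  have x0U: "x0 \<in> U" using x0 r by (simp add: U_def y0_def)
  have "descent (Suc p) \<delta> f T U"
    unfolding descent_def
  proof (intro conjI ballI impI)
    show "\<delta> > 0" by (rule \<delta>)
    show "continuous_map (prod_topology (top_of_set {0..1}) M) M T"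
      unfolding T_def by (rule continuous_map_chart_push[OF c r(1) rV v])
    show "T (0, x) = x" for x by (rule fix_pt) auto
    show "h (T (t, x)) \<le> h x" if "h \<in> Cp (Suc p)" "\<forall>x\<in>topspace M. C1_near \<delta> h f x" "t \<in> {0..1}" for h t x
    proof (cases "x \<in> cdom c \<and> t * max 0 (r - dist (cmap c x) y0) > 0")
      case True
      then show ?thesis using dec[of h t x] that by auto
    next
      case False
      then show ?thesis using fix_pt[of x t] that by simp
    qed
    show "T (1, x) = x \<or> f (T (1, x)) < f x" for x
      using dec[OF f ff, of 1 x] fix_pt[of x 1] by fastforce
    show "x \<in> topspace M" if "x \<in> U" for x using that U openin_subset by blast
    show "f (T (1, x)) < f x" if "x \<in> U" for x
      using that by (intro dec[OF f ff]) (auto simp: U_def dist_commute)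
  qed
  then show ?thesis using U x0U by blast
qed

section \<open>Composing descents and covering a compact set\<close>

lemma descent_trivial:
  assumes "f \<in> Cp p"
  shows "descent p 1 f snd {}"
  unfolding descent_def by (auto intro: continuous_map_snd)

lemma descent_in_topspace:
  assumes "descent p \<delta> f T U" "t \<in> {0..1}" "x \<in> topspace M"
  shows "T (t, x) \<in> topspace M"
  using assms continuous_map_image_subset_topspace[of _ M T] unfolding descent_def by fastforce

lemma descent_self:
  assumes "descent p \<delta> f T U" "f \<in> Cp p" "t \<in> {0..1}" "x \<in> topspace M"
  shows "f (T (t, x)) \<le> f x"
proof -
  have "C1_near \<delta> f f x" for x
    using assms C1_near_mono[OF C1_near_refl] unfolding descent_def by auto
  then show ?thesis using assms unfolding descent_def by blast
qed

text \<open>\<open>S\<close> may carry a point of \<open>W\<close> out of \<open>W\<close>, but then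
  \<open>f\<close> has already dropped and \<open>T\<close> cannot raise it again. If
  \<open>S\<close> fixes the point, \<open>T\<close> acts on that point itself.\<close>

lemma descent_compose:
  assumes f: "f \<in> Cp p" and S: "descent p \<delta> f S U" and T: "descent p \<epsilon> f T W"
  shows "descent p (min \<delta> \<epsilon>) f (\<lambda>z. T (fst z, S z)) (U \<union> W)"
  unfolding descent_def
proof (intro conjI ballI impI)
  note in_top = descent_in_topspace[OF S]
  show "min \<delta> \<epsilon> > 0" using S T by (simp add: descent_def)
  have "continuous_map (prod_topology (top_of_set {0..1}) M) (prod_topology (top_of_set {0..1}) M)
      (\<lambda>z. (fst z, S z))"
    using S by (intro continuous_map_pairedI continuous_map_fst) (simp add: descent_def)
  then show "continuous_map (prod_topology (top_of_set {0..1}) M) M (\<lambda>z. T (fst z, S z))"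
    using T continuous_map_compose[of _ _ "\<lambda>z. (fst z, S z)" M T] by (simp add: descent_def o_def)
  show "T (fst (0, x), S (0, x)) = x" if "x \<in> topspace M" for x
    using S T that by (simp add: descent_def)
  show "h (T (fst (t, x), S (t, x))) \<le> h x"
    if h: "h \<in> Cp p" "\<forall>x\<in>topspace M. C1_near (min \<delta> \<epsilon>) h f x" and t: "t \<in> {0..1}" and x: "x \<in> topspace M"
    for h t x
  proof -
    have "\<forall>x\<in>topspace M. C1_near \<delta> h f x" "\<forall>x\<in>topspace M. C1_near \<epsilon> h f x"
      using h(2) C1_near_mono by (meson min.cobounded1 min.cobounded2)+
    then have "h (T (t, S (t, x))) \<le> h (S (t, x))" "h (S (t, x)) \<le> h x"
      using S T h(1) t x in_top[OF t x] unfolding descent_def by blast+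
    then show ?thesis by simp
  qed
  have alt: "T (1, S (1, x)) = x \<and> x \<notin> U \<union> W \<or> f (T (1, S (1, x))) < f x" if x: "x \<in> topspace M" for x
  proof -
    have "f (S (1, x)) < f x \<or> S (1, x) = x \<and> x \<notin> U"
      using S x unfolding descent_def by fastforce
    then show ?thesis
    proof
      assume "f (S (1, x)) < f x"
      moreover have "f (T (1, S (1, x))) \<le> f (S (1, x))"
        using in_top[OF _ x, of 1] by (intro descent_self[OF T f]) auto
      ultimately show ?thesis by linarith
    next
      assume "S (1, x) = x \<and> x \<notin> U"
      moreover have "f (T (1, x)) < f x \<or> T (1, x) = x \<and> x \<notin> W"
        using T x unfolding descent_def by fastforce
      ultimately show ?thesis by auto
    qed
  qed
  show "T (fst (1, x), S (1, x)) = x \<or> f (T (fst (1, x), S (1, x))) < f x" if "x \<in> topspace M" for x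
    using alt[OF that] by auto
  show "x \<in> topspace M" if "x \<in> U \<union> W" for x using S T that unfolding descent_def by blast
  then show "f (T (fst (1, x), S (1, x))) < f x" if "x \<in> U \<union> W" for x
    using alt[of x] that by auto
qed

text \<open>Compactness reduces the cover to finitely many pushes, so the common radius
  \<open>\<delta>\<close>, a minimum of finitely many positive numbers, stays positive.\<close>

lemma compact_descent:
  assumes f: "f \<in> Cp (Suc p)" and K: "compactin M K"
    and nz: "\<And>x. x \<in> K \<Longrightarrow> differential_nonzero f x"
  obtains T \<delta> U where "descent (Suc p) \<delta> f T U" "K \<subseteq> U"
proof -
  define \<U> where "\<U> = {U. openin M U \<and> (\<exists>T \<delta>. descent (Suc p) \<delta> f T U)}"
  have "K \<subseteq> \<Union>\<U>"
  proof
    fix x assume "x \<in> K"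
    from local_descent[OF f nz[OF this]] obtain U T \<delta>
      where "openin M U" "x \<in> U" "descent (Suc p) \<delta> f T U" by (elim exE conjE)
    then show "x \<in> \<Union>\<U>" unfolding \<U>_def by blast
  qed
  moreover have "\<forall>U\<in>\<U>. openin M U" by (simp add: \<U>_def)
  ultimately obtain \<F> where \<F>: "finite \<F>" "\<F> \<subseteq> \<U>" "K \<subseteq> \<Union>\<F>"
    using compactinD[OF K, of \<U>] by auto
  from \<F>(1,2) have "\<exists>T \<delta>. descent (Suc p) \<delta> f T (\<Union>\<F>)"
  proof (induction \<F> rule: finite_induct)
    case empty
    then show ?case using descent_trivial[OF f] by auto
  next
    case (insert U \<F>)
    then obtain S \<epsilon> T \<delta> where "descent (Suc p) \<epsilon> f S U" "descent (Suc p) \<delta> f T (\<Union>\<F>)"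
      by (auto simp: \<U>_def)
    from descent_compose[OF f this] show ?case by auto
  qed
  then show thesis using \<F>(3) that by blast
qed

end


section \<open>Stability of sublevel sets\<close>

lemma compactin_positive_lower_bound:
  assumes C: "compactin X C" and cont: "continuous_map X euclideanreal \<psi>"
    and pos: "\<And>x. x \<in> C \<Longrightarrow> \<psi> x > 0"
  shows "\<exists>\<eta>>0. \<forall>x\<in>C. \<eta> \<le> \<psi> x"
proof (cases "C = {}")
  case False
  have "compact (\<psi> ` C)" using image_compactin[OF C cont] by simp
  then obtain m where "m \<in> \<psi> ` C" "\<forall>t\<in>\<psi> ` C. m \<le> t"
    using compact_attains_inf[of "\<psi> ` C"] False by auto
  then show ?thesis using pos by (intro exI[of _ m]) auto
qed (auto intro: exI[of _ 1])

context riemannian_manifold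
begin

lemma euler_char_sublevel_eq:
  assumes T: "descent p \<delta> f T U" and f: "f \<in> Cp p" and h: "h \<in> Cp p"
    and near: "\<And>x. x \<in> topspace M \<Longrightarrow> C1_near \<delta> h f x"
    and fh: "\<And>x. x \<in> topspace M \<Longrightarrow> f x \<le> a \<Longrightarrow> h (T (1, x)) \<le> b"
    and hf: "\<And>x. x \<in> topspace M \<Longrightarrow> h x \<le> b \<Longrightarrow> f (T (1, x)) \<le> a"
  shows "euler_char (subtopology M (sublevel f a)) = euler_char (subtopology M (sublevel h b))"
proof (intro homotopy_equivalent_space_imp_euler_char_eq homotopy_equivalent_by_common_deformation)
  show "continuous_map (prod_topology (top_of_set {0..1::real}) M) M T"
    "\<And>x. x \<in> topspace M \<Longrightarrow> T (0, x) = x"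
    using T by (auto simp: descent_def)
  note in_top = descent_in_topspace[OF T]
  have hT: "h (T (t, x)) \<le> h x" if "t \<in> {0..1}" "x \<in> topspace M" for t x
    using T h near that unfolding descent_def by blast
  show "T (t, x) \<in> sublevel f a" if "t \<in> {0..1}" "x \<in> sublevel f a" for t x
    using that in_top descent_self[OF T f, of t x] by (auto simp: sublevel_def)
  show "T (t, x) \<in> sublevel h b" if "t \<in> {0..1}" "x \<in> sublevel h b" for t x
    using that in_top hT[of t x] by (auto simp: sublevel_def)
  show "T (1, x) \<in> sublevel h b" if "x \<in> sublevel f a" for x
    using that in_top fh by (auto simp: sublevel_def)
  show "T (1, x) \<in> sublevel f a" if "x \<in> sublevel h b" for x
    using that in_top hf by (auto simp: sublevel_def)
qed (auto simp: sublevel_def)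

text \<open>Where \<open>f x - a\<close> is smaller than the positive function below, \<open>T\<close> pushes \<open>x\<close> into \<open>f < a\<close>
  by at least that amount; so this function measures how far \<open>f\<close> may be perturbed.\<close>

lemma regular_level_descent:
  assumes f: "f \<in> Cp (Suc p)" and reg: "regular_value f a"
    and K: "compactin M {x \<in> topspace M. f x = a}"
  shows "\<exists>T \<delta> U. descent (Suc p) \<delta> f T U \<and>
    continuous_map M euclideanreal (\<lambda>x. max (f x - a) (a - f (T (1, x)))) \<and>
    (\<forall>x\<in>topspace M. max (f x - a) (a - f (T (1, x))) > 0)"
proof -
  obtain T \<delta> U where T: "descent (Suc p) \<delta> f T U" and U: "{x \<in> topspace M. f x = a} \<subseteq> U"
    by (rule compact_descent[OF f K]) (use reg in \<open>auto simp: regular_value_def\<close>)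
  have cf: "continuous_map M euclideanreal f" by (rule continuous_map_Cp[OF f])
  have "continuous_map M (prod_topology (top_of_set {0..1::real}) M) (\<lambda>x. (1, x))"
    by (intro continuous_map_pairedI) auto
  from continuous_map_compose[OF this, of M T] T
  have T1: "continuous_map M M (\<lambda>x. T (1, x))" by (simp add: o_def descent_def)
  have "continuous_map M euclideanreal (\<lambda>x. f (T (1, x)))"
    using continuous_map_compose[OF T1 cf] by (simp add: o_def)
  then have cont: "continuous_map M euclideanreal (\<lambda>x. max (f x - a) (a - f (T (1, x))))"
    using cf by (intro continuous_map_real_max continuous_map_diff) auto
  have "max (f x - a) (a - f (T (1, x))) > 0" if x: "x \<in> topspace M" for x
  proof (cases "f x = a")
    case True
    then have "f (T (1, x)) < f x" using T U x unfolding descent_def by blast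
    then show ?thesis using True by simp
  next
    case False
    have "f (T (1, x)) \<le> f x" using x by (intro descent_self[OF T f]) auto
    then show ?thesis using False by (auto simp: less_max_iff_disj)
  qed
  with T cont show ?thesis by blast
qed

text \<open>Asking for one radius \<open>r\<close> strictly below \<open>\<epsilon>\<close> at all
  points leaves the room \<open>\<epsilon> - r\<close>, half of which is granted to a further
  perturbation. Pointwise strict inequalities alone could approach \<open>\<epsilon>\<close> and
  leave no uniform room.\<close>

lemma openin_uniform_C1_near:
  "openin (uniform_Cp_topology (Suc p))
    {h \<in> Cp (Suc p). \<exists>r. 0 \<le> r \<and> r < \<epsilon> \<and> (\<forall>x\<in>topspace M. C1_near r h f x)}" (is "openin _ ?W")
  unfolding openin_uniform_Cp_topology
proof (intro conjI ballI)
  fix h assume "h \<in> ?W"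
  then obtain r where h: "h \<in> Cp (Suc p)" and r: "0 \<le> r" "r < \<epsilon>"
    and near: "\<And>x. x \<in> topspace M \<Longrightarrow> C1_near r h f x" by auto
  define s where "s = (\<epsilon> - r) / 2"
  have s: "s > 0" "s + r < \<epsilon>" using r by (auto simp: s_def field_simps)
  let ?N = "{u \<in> Cp (Suc p). (\<Sum>i\<le>Suc p. nabla_supnorm i u) < ennreal s}"
  have "?N \<in> uniform_nhds (Suc p)" unfolding uniform_nhds_def using s by blast
  moreover have "k \<in> ?W" if k: "k \<in> Cp (Suc p)" "fun_diff k h \<in> ?N" for k
  proof -
    have le: "nabla_norm i (fun_diff k h) x \<le> s" if x: "x \<in> topspace M" and i: "i \<le> Suc p" for i x
    proof -
      have "ennreal (nabla_norm i (fun_diff k h) x) \<le> nabla_supnorm i (fun_diff k h)"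
        unfolding nabla_supnorm_def by (rule SUP_upper[OF x])
      also have "\<dots> \<le> (\<Sum>i\<le>Suc p. nabla_supnorm i (fun_diff k h))"
        using i by (intro member_le_sum) auto
      also have "\<dots> < ennreal s" using k by simp
      finally have "ennreal (nabla_norm i (fun_diff k h) x) < ennreal s" .
      then show ?thesis using s by (simp add: ennreal_less_iff[OF nabla_norm_nonneg[OF x]])
    qed
    have "C1_near (s + r) k f x" if x: "x \<in> topspace M" for x
      using C1_near_trans[OF C1_near_if_nabla_norm_le[OF k(1) h x le[OF x] le[OF x]] near[OF x]]
      by simp
    then show ?thesis using k(1) r s by (auto intro!: exI[of _ "s + r"])
  qed
  ultimately show "\<exists>N\<in>uniform_nhds (Suc p). {k \<in> Cp (Suc p). fun_diff k h \<in> N} \<subseteq> ?W"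
    by (intro bexI[of _ ?N]) blast+
qed blast

text \<open>The radius is a continuous function so that half of the gap
  \<open>\<epsilon> - \<rho>\<close>, being continuous and positive, is itself an admissible weight
  in \<open>strong_nhds\<close>.\<close>

lemma openin_strong_C1_near:
  assumes \<epsilon>: "continuous_map M euclideanreal \<epsilon>"
  shows "openin (strong_Cp_topology (Suc p))
    {h \<in> Cp (Suc p). \<exists>\<rho>. continuous_map M euclideanreal \<rho> \<and>
       (\<forall>x\<in>topspace M. 0 \<le> \<rho> x \<and> \<rho> x < \<epsilon> x \<and> C1_near (\<rho> x) h f x)}" (is "openin _ ?W")
  unfolding openin_strong_Cp_topology
proof (intro conjI ballI)
  fix h assume "h \<in> ?W"
  then obtain \<rho> where h: "h \<in> Cp (Suc p)" and \<rho>: "continuous_map M euclideanreal \<rho>"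
    and near: "\<And>x. x \<in> topspace M \<Longrightarrow> 0 \<le> \<rho> x \<and> \<rho> x < \<epsilon> x \<and> C1_near (\<rho> x) h f x" by auto
  define s where "s x = (\<epsilon> x - \<rho> x) * (1 / 2)" for x
  have s: "s x > 0" "s x + \<rho> x < \<epsilon> x" if "x \<in> topspace M" for x
    using near[OF that] by (auto simp: s_def field_simps)
  have cs: "continuous_map M euclideanreal s"
    unfolding s_def using \<epsilon> \<rho> by (intro continuous_map_real_mult continuous_map_diff) auto
  let ?N = "{u \<in> Cp (Suc p). \<forall>x\<in>topspace M. (\<Sum>i\<le>Suc p. nabla_norm i u x) < s x}"
  have "?N \<in> strong_nhds (Suc p)" unfolding strong_nhds_def using s(1) cs by blast
  moreover have "k \<in> ?W" if k: "k \<in> Cp (Suc p)" "fun_diff k h \<in> ?N" for k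
  proof -
    have le: "nabla_norm i (fun_diff k h) x \<le> s x" if x: "x \<in> topspace M" and i: "i \<le> Suc p" for i x
    proof -
      have "nabla_norm i (fun_diff k h) x \<le> (\<Sum>i\<le>Suc p. nabla_norm i (fun_diff k h) x)"
        using i nabla_norm_nonneg[OF x] by (intro member_le_sum) auto
      then show ?thesis using k x by auto
    qed
    have "C1_near (s x + \<rho> x) k f x" if x: "x \<in> topspace M" for x
      using C1_near_trans[OF C1_near_if_nabla_norm_le[OF k(1) h x le[OF x] le[OF x]]] near[OF x]
      by simp
    moreover have "continuous_map M euclideanreal (\<lambda>x. s x + \<rho> x)"
      using cs \<rho> by (intro continuous_map_add)
    moreover have "0 \<le> s x + \<rho> x" if "x \<in> topspace M" for x
      using s(1)[OF that] near[OF that] by linarith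
    ultimately show ?thesis using k(1) s(2) by (auto intro!: exI[of _ "\<lambda>x. s x + \<rho> x"])
  qed
  ultimately show "\<exists>N\<in>strong_nhds (Suc p). {k \<in> Cp (Suc p). fun_diff k h \<in> N} \<subseteq> ?W"
    by (intro bexI[of _ ?N]) blast+
qed blast

section \<open>Local constancy on the two function spaces\<close>

lemma C1_near_imp_abs_le: "C1_near r h f x \<Longrightarrow> \<bar>h x - f x\<bar> \<le> r"
  by (simp add: C1_near_def)

lemma locally_constant_euler_char_Reg_pb:
  "locally_constant
     (subtopology (prod_topology (uniform_Cp_topology (Suc p)) euclideanreal) (Reg_pb (Suc p)))
     (\<lambda>(f, a). euler_char (subtopology M (sublevel f a)))"
  unfolding locally_constant_def
proof
  fix z assume "z \<in> topspace (subtopology (prod_topology (uniform_Cp_topology (Suc p)) euclideanreal) (Reg_pb (Suc p)))"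
  then have zR: "z \<in> Reg_pb (Suc p)" by auto
  obtain f a where z: "z = (f, a)" by (cases z)
  have f: "f \<in> Cp (Suc p)" and proper: "proper_map M euclideanreal f"
    and bdd: "bdd_below (f ` topspace M)" and reg: "regular_value f a"
    using zR by (auto simp: z Reg_pb_def)
  have level: "compactin M {x \<in> topspace M. f x = a}"
    using proper by (simp add: proper_map_def)
  obtain m where m: "\<And>x. x \<in> topspace M \<Longrightarrow> m \<le> f x" using bdd by (auto simp: bdd_below_def)
  \<comment> \<open>A point with \<open>h x \<le> b\<close> may have \<open>f x\<close> slightly
    above \<open>a\<close>, so a compact set reaching beyond the level \<open>a\<close> is required.
    The lower bound \<open>m\<close> turns the sublevel set into the preimage of a compact
    interval.\<close>
  have "compactin M {x \<in> topspace M. f x \<in> {m..a + 1}}"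
    by (rule compactin_proper_map_preimage[OF proper]) simp
  also have "{x \<in> topspace M. f x \<in> {m..a + 1}} = sublevel f (a + 1)"
    using m by (auto simp: sublevel_def)
  finally have C: "compactin M (sublevel f (a + 1))" .
  obtain T \<delta> U where T: "descent (Suc p) \<delta> f T U"
    and cont: "continuous_map M euclideanreal (\<lambda>x. max (f x - a) (a - f (T (1, x))))"
    and pos: "\<forall>x\<in>topspace M. max (f x - a) (a - f (T (1, x))) > 0"
    using regular_level_descent[OF f reg level] by (elim exE conjE)
  obtain \<eta>' where \<eta>': "\<eta>' > 0" "\<And>x. x \<in> sublevel f (a + 1) \<Longrightarrow> \<eta>' \<le> max (f x - a) (a - f (T (1, x)))"
    using compactin_positive_lower_bound[OF C cont] pos by (auto simp: sublevel_def)
  \<comment> \<open>Strictly below \<open>\<eta>'\<close>, so that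
    \<open>f x - a \<le> \<eta>\<close> rules out the first argument of \<open>max\<close>; at most
    1, so that \<open>f x \<le> a + \<eta>\<close> stays inside the compact set.\<close>
  define \<eta> where "\<eta> = min \<eta>' 1 / 2"
  have \<eta>: "\<eta> > 0" "\<eta> < \<eta>'" "\<eta> \<le> 1" using \<eta>'(1) by (auto simp: \<eta>_def min_def)
  have drop: "f (T (1, x)) \<le> a - \<eta>" if "x \<in> topspace M" "f x \<le> a + \<eta>" for x
    using \<eta>'(2)[of x] that \<eta> by (auto simp: sublevel_def le_max_iff_disj)
  \<comment> \<open>The errors \<open>h - f\<close> and \<open>b - a\<close> each cost less than
    \<open>\<epsilon>\<close>, and together they must not exceed \<open>\<eta>\<close>.\<close>
  define \<epsilon> where "\<epsilon> = min \<delta> (\<eta> / 2)"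
  have \<epsilon>: "\<epsilon> > 0" "\<epsilon> \<le> \<delta>" "2 * \<epsilon> \<le> \<eta>" using \<eta> T by (auto simp: \<epsilon>_def descent_def)
  define W where "W = {h \<in> Cp (Suc p). \<exists>r. 0 \<le> r \<and> r < \<epsilon> \<and> (\<forall>x\<in>topspace M. C1_near r h f x)}"
  have "openin (prod_topology (uniform_Cp_topology (Suc p)) euclideanreal) (W \<times> ball a \<epsilon>)"
    unfolding openin_prod_Times_iff W_def using openin_uniform_C1_near by simp
  then have opn: "openin (subtopology (prod_topology (uniform_Cp_topology (Suc p)) euclideanreal) (Reg_pb (Suc p)))
      (Reg_pb (Suc p) \<inter> W \<times> ball a \<epsilon>)"
    by (rule openin_subtopology_Int2)
  have zW: "z \<in> Reg_pb (Suc p) \<inter> W \<times> ball a \<epsilon>"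
    using zR f \<epsilon> C1_near_refl by (auto simp: z W_def intro!: exI[of _ 0])
  have eq: "euler_char (subtopology M (sublevel h b)) = euler_char (subtopology M (sublevel f a))"
    if hW: "h \<in> W" and b: "b \<in> ball a \<epsilon>" for h b
  proof -
    obtain r where h: "h \<in> Cp (Suc p)" and r: "r < \<epsilon>" and near: "\<And>x. x \<in> topspace M \<Longrightarrow> C1_near r h f x"
      using hW unfolding W_def by blast
    have hf: "\<bar>h x - f x\<bar> < \<epsilon>" if "x \<in> topspace M" for x
      using C1_near_imp_abs_le[OF near[OF that]] r by linarith
    have ab: "\<bar>b - a\<bar> < \<epsilon>" using b by (simp add: dist_real_def abs_minus_commute)
    have "euler_char (subtopology M (sublevel f a)) = euler_char (subtopology M (sublevel h b))"
    proof (rule euler_char_sublevel_eq[OF T f h])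
      show "C1_near \<delta> h f x" if "x \<in> topspace M" for x
        using C1_near_mono[OF near[OF that]] r \<epsilon> by simp
      show "h (T (1, x)) \<le> b" if x: "x \<in> topspace M" "f x \<le> a" for x
      proof -
        have "T (1, x) \<in> topspace M" using x by (intro descent_in_topspace[OF T]) auto
        then show ?thesis using hf[of "T (1, x)"] drop[of x] x ab \<epsilon> \<eta> by linarith
      qed
      show "f (T (1, x)) \<le> a" if x: "x \<in> topspace M" "h x \<le> b" for x
        using hf[OF x(1)] drop[of x] x ab \<epsilon> \<eta> by linarith
    qed
    then show ?thesis ..
  qed
  show "\<exists>W. openin (subtopology (prod_topology (uniform_Cp_topology (Suc p)) euclideanreal) (Reg_pb (Suc p))) W \<and>
      z \<in> W \<and> (\<forall>w\<in>W. (case w of (f, a) \<Rightarrow> euler_char (subtopology M (sublevel f a))) =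
        (case z of (f, a) \<Rightarrow> euler_char (subtopology M (sublevel f a))))"
  proof (intro exI conjI ballI)
    fix w assume "w \<in> Reg_pb (Suc p) \<inter> W \<times> ball a \<epsilon>"
    then obtain h b where "w = (h, b)" "h \<in> W" "b \<in> ball a \<epsilon>" by blast
    then show "(case w of (f, a) \<Rightarrow> euler_char (subtopology M (sublevel f a))) =
        (case z of (f, a) \<Rightarrow> euler_char (subtopology M (sublevel f a)))"
      using eq by (simp only: z prod.case)
  qed (fact opn zW)+
qed

text \<open>Compactness is given only for \<open>f \<le> 0\<close>, while \<open>h x \<le> 0\<close>
  may hold at points with \<open>f x > 0\<close> anywhere in \<open>M\<close>. There the pointwise
  bound by \<open>\<psi>\<close> replaces a constant: \<open>f x < \<psi> x\<close> forces
  \<open>\<psi> x = - f (T (1, x))\<close>.\<close>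

lemma locally_constant_euler_char_C_0reg_c:
  "locally_constant (subtopology (strong_Cp_topology (Suc p)) (C_0reg_c (Suc p)))
     (\<lambda>f. euler_char (subtopology M (sublevel f 0)))"
  unfolding locally_constant_def
proof
  fix f assume "f \<in> topspace (subtopology (strong_Cp_topology (Suc p)) (C_0reg_c (Suc p)))"
  then have fC: "f \<in> C_0reg_c (Suc p)" by auto
  then have f: "f \<in> Cp (Suc p)" and reg: "regular_value f 0" and C: "compactin M (sublevel f 0)"
    by (auto simp: C_0reg_c_def)
  have "closedin M {x \<in> topspace M. f x \<in> {0}}"
    by (rule closedin_continuous_map_preimage[OF continuous_map_Cp[OF f]]) simp
  then have level: "compactin M {x \<in> topspace M. f x = 0}"
    by (intro closed_compactin[OF C]) (auto simp: sublevel_def)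
  obtain T \<delta> U where T: "descent (Suc p) \<delta> f T U"
    and cont: "continuous_map M euclideanreal (\<lambda>x. max (f x - 0) (0 - f (T (1, x))))"
    and pos: "\<forall>x\<in>topspace M. max (f x - 0) (0 - f (T (1, x))) > 0"
    using regular_level_descent[OF f reg level] by (elim exE conjE)
  define \<psi> where "\<psi> x = max (f x - 0) (0 - f (T (1, x)))" for x
  have \<psi>: "continuous_map M euclideanreal \<psi>" "\<And>x. x \<in> topspace M \<Longrightarrow> \<psi> x > 0"
    using cont pos by (simp_all add: \<psi>_def[abs_def])
  obtain \<eta> where \<eta>: "\<eta> > 0" "\<And>x. x \<in> sublevel f 0 \<Longrightarrow> \<eta> \<le> \<psi> x"
    using compactin_positive_lower_bound[OF C \<psi>(1)] \<psi>(2) by (auto simp: sublevel_def)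
  \<comment> \<open>\<open>\<delta>\<close> makes \<open>T\<close> lower \<open>h\<close>, and
    \<open>\<psi> x\<close> treats points with \<open>h x \<le> 0\<close>. The constant
    \<open>\<eta>\<close> treats points with \<open>f x \<le> 0\<close>: there the error
    \<open>h - f\<close> is evaluated at the moved point \<open>T (1, x)\<close>, where a bound by
    \<open>\<psi>\<close> would not compare with the drop at \<open>x\<close>.\<close>
  define \<epsilon> where "\<epsilon> x = min (min \<delta> \<eta>) (\<psi> x)" for x
  have \<epsilon>: "continuous_map M euclideanreal \<epsilon>" "\<And>x. x \<in> topspace M \<Longrightarrow> \<epsilon> x > 0"
    "\<And>x. \<epsilon> x \<le> \<delta>" "\<And>x. \<epsilon> x \<le> \<eta>" "\<And>x. \<epsilon> x \<le> \<psi> x"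
    unfolding \<epsilon>_def using \<psi> \<eta>(1) T by (auto intro!: continuous_map_real_min simp: descent_def)
  define W where "W = {h \<in> Cp (Suc p). \<exists>\<rho>. continuous_map M euclideanreal \<rho> \<and>
       (\<forall>x\<in>topspace M. 0 \<le> \<rho> x \<and> \<rho> x < \<epsilon> x \<and> C1_near (\<rho> x) h f x)}"
  have opn: "openin (subtopology (strong_Cp_topology (Suc p)) (C_0reg_c (Suc p))) (C_0reg_c (Suc p) \<inter> W)"
    unfolding W_def by (rule openin_subtopology_Int2[OF openin_strong_C1_near[OF \<epsilon>(1)]])
  have fW: "f \<in> C_0reg_c (Suc p) \<inter> W"
    using fC f \<epsilon>(2) C1_near_refl by (auto simp: W_def intro!: exI[of _ "\<lambda>_. 0"])
  have eq: "euler_char (subtopology M (sublevel h 0)) = euler_char (subtopology M (sublevel f 0))"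
    if hW: "h \<in> W" for h
  proof -
    obtain \<rho> where h: "h \<in> Cp (Suc p)"
      and near: "\<And>x. x \<in> topspace M \<Longrightarrow> \<rho> x < \<epsilon> x \<and> C1_near (\<rho> x) h f x"
      using hW unfolding W_def by blast
    have hf: "\<bar>h x - f x\<bar> < \<epsilon> x" if "x \<in> topspace M" for x
      using C1_near_imp_abs_le[of "\<rho> x" h f x] near[OF that] by linarith
    have "euler_char (subtopology M (sublevel f 0)) = euler_char (subtopology M (sublevel h 0))"
    proof (rule euler_char_sublevel_eq[OF T f h])
      show "C1_near \<delta> h f x" if "x \<in> topspace M" for x
        using C1_near_mono[of "\<rho> x" h f x \<delta>] near[OF that] \<epsilon>(3)[of x] by linarith
      show "h (T (1, x)) \<le> 0" if x: "x \<in> topspace M" "f x \<le> 0" for x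
      proof -
        have "T (1, x) \<in> topspace M" using x by (intro descent_in_topspace[OF T]) auto
        moreover have "f (T (1, x)) \<le> - \<eta>"
          using \<eta>(2)[of x] \<eta>(1) x by (auto simp: sublevel_def \<psi>_def le_max_iff_disj)
        ultimately show ?thesis using hf[of "T (1, x)"] \<epsilon>(4)[of "T (1, x)"] by linarith
      qed
      show "f (T (1, x)) \<le> 0" if x: "x \<in> topspace M" "h x \<le> 0" for x
        using hf[OF x(1)] x(2) \<epsilon>(5)[of x] unfolding \<psi>_def by linarith
    qed
    then show ?thesis ..
  qed
  show "\<exists>W. openin (subtopology (strong_Cp_topology (Suc p)) (C_0reg_c (Suc p))) W \<and> f \<in> W \<and>
      (\<forall>h\<in>W. euler_char (subtopology M (sublevel h 0)) = euler_char (subtopology M (sublevel f 0)))"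
  proof (intro exI conjI ballI)
    fix h assume "h \<in> C_0reg_c (Suc p) \<inter> W"
    then show "euler_char (subtopology M (sublevel h 0)) = euler_char (subtopology M (sublevel f 0))"
      by (intro eq) simp
  qed (fact opn fW)+
qed

end

theorem mainTheorem4:
  fixes M :: "'a topology"
    and B :: "'e::euclidean_space set"
    and A :: "('a, 'e) chart set"
    and g :: "('a, 'e) chart \<Rightarrow> 'e \<Rightarrow> 'e \<Rightarrow> 'a \<Rightarrow> real"
  assumes "riemannian_manifold M B A g"
  shows "locally_constant
           (subtopology
             (prod_topology (riemannian_manifold.uniform_Cp_topology M B A g 3) euclideanreal)
             (smooth_manifold.Reg_pb M B A 3))
           (\<lambda>(f, a). euler_char (subtopology M (smooth_manifold.sublevel M f a)))
       \<and> locally_constant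
           (subtopology (riemannian_manifold.strong_Cp_topology M B A g 3)
             (smooth_manifold.C_0reg_c M B A 3))
           (\<lambda>f. euler_char (subtopology M (smooth_manifold.sublevel M f 0)))"
proof -
  interpret riemannian_manifold M B A g by fact
  have "(3::nat) = Suc 2" by simp
  then show ?thesis
    using locally_constant_euler_char_Reg_pb[of 2] locally_constant_euler_char_C_0reg_c[of 2]
    by (simp only:)
qed

end
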